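(* Let $r\ge1$ and let $\lambda,\mu$ be partitions with $\ell(\lambda)\le r$, $\ell(\mu)\le r$ (padded with zeros to $r$ parts). Then $$g_\mu^\perp G^r_\lambda(x)=\det\left(\sum_{n=0}^\infty\ \sum_{k=0}^{\mu_j-j+r}\binom{1-j}{k}\binom{i-1}{n-k}\beta^n\,h_{\lambda_i-\mu_j-i+j+n}(x)\right)_{1\le i,j\le r}.$$
   Context: The ground field is $\mathbb{C}(\beta)$; $\Lambda$ is the algebra of symmetric functions in $x=(x_1,x_2,\dots)$ over it, with Schur functions $s_\lambda$, complete symmetric functions $h_m$ ($h_0=1$, $h_m=0$ for $m<0$), and Hall inner product $\langle s_\lambda,s_\mu\rangle=\delta_{\lambda,\mu}$. $I_n=\mathrm{span}\{s_\lambda:\ell(\lambda)>n\}$ and $\widehat\Lambda=\varprojlim\Lambda/I_n$; elements of $\widehat\Lambda$ are formal sums $\sum c_\lambda s_\lambda$ such that for every $n$ only finitely many $\lambda$ with $\ell(\lambda)\le n$ have $c_\lambda\neq0$. The Hall product extends to $\widehat\Lambda\times\Lambda\to \mathbb{C}(\beta)$. For $f\in\Lambda$, $f^\perp$ is defined by $\langle f^\perp g,h\rangle=\langle g,fh\rangle$ for all $h\in\Lambda$. The stable Grothendieck polynomial $G_\lambda(x)\in\widehat\Lambda$ is the unique element such that for all $n\ge\ell(\lambda)$, $G_\lambda(x_1,\dots,x_n):=G_\lambda(x_1,\dots,x_n,0,0,\dots)=\det\bigl(x_i^{\lambda_j+n-j}(1+\beta x_i)^{j-1}\bigr)_{1\le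 i,j\le n}/\prod_{1\le i<j\le n}(x_i-x_j)$. The dual stable Grothendieck polynomials $g_\mu\in\Lambda$ are determined by $\langle G_\lambda,g_\mu\rangle=\delta_{\lambda,\mu}$. The $r$-th truncation is $G^r_\lambda(x)=\iota_r(G_\lambda(x_1,\dots,x_r))\in\Lambda$, where $\iota_r$ is the linear map from symmetric polynomials in $x_1,\dots,x_r$ to $\Lambda$ sending $s_\nu(x_1,\dots,x_r)$ to $s_\nu(x)$ for $\ell(\nu)\le r$. Binomials: $\binom{a}{n}=a(a-1)\cdots(a-n+1)/n!$ for $a\in\mathbb Z$, $n\ge0$, and $\binom an=0$ for $n<0$ (so the sum over $n$ is finite). *)

theory Defs
  imports
    "HOL-Library.Multiset"
    "HOL-Library.Groups_Big_Fun"
    "HOL-Computational_Algebra.Polynomial"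
    "HOL-Computational_Algebra.Fraction_Field"
    "Jordan_Normal_Form.Determinant"
begin

section \<open>Formal power series in countably many variables\<close>

text \<open>
  A monomial is a finite multiset of variable indices; its degree is the size of the multiset.
  Series of this type may have unbounded degree and infinitely many monomials in each degree.
\<close>

typedef 'a mseries = "UNIV :: (nat multiset \<Rightarrow> 'a) set"
  morphisms mcoeff MSeries ..

setup_lifting type_definition_mseries

lemma mseries_eqI: "(\<And>M. mcoeff f M = mcoeff g M) \<Longrightarrow> f = g"
  by (metis ext mcoeff_inject)

lemma finite_submultisets [simp]: "finite {A. A \<subseteq># (M :: 'b multiset)}"
proof (induction M)
  case empty
  show ?case by simp
next
  case (add x M)
  have "{A. A \<subseteq># add_mset x M} \<subseteq> {A. A \<subseteq># M} \<union> add_mset x ` {A. A \<subseteq># M}"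
  proof
    fix A assume "A \<in> {A. A \<subseteq># add_mset x M}"
    then have A: "A \<subseteq># add_mset x M" by simp
    show "A \<in> {A. A \<subseteq># M} \<union> add_mset x ` {A. A \<subseteq># M}"
    proof (cases "x \<in># A")
      case True
      then obtain B where "A = add_mset x B" by (metis insert_DiffM)
      with A show ?thesis by auto
    next
      case False
      then have "count A x = 0" by (simp add: not_in_iff)
      moreover have "count A y \<le> count (add_mset x M) y" for y
        using A by (simp add: subseteq_mset_def)
      ultimately have "A \<subseteq># M"
        by (metis count_add_mset le0 subseteq_mset_def)
      then show ?thesis by simp
    qed
  qed
  then show ?case using add.IH by (meson finite_UnI finite_imageI finite_subset)
qed

lemma double_diff_mset: "A \<subseteq># M \<Longrightarrow> M - (M - A) = (A :: 'b multiset)"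
  by (simp add: multiset_eq_iff subseteq_mset_def)

instantiation mseries :: (comm_ring_1) comm_ring_1
begin

lift_definition zero_mseries :: "'a mseries" is "\<lambda>_. 0" .

lift_definition one_mseries :: "'a mseries" is "\<lambda>M. if M = {#} then 1 else 0" .

lift_definition plus_mseries :: "'a mseries \<Rightarrow> 'a mseries \<Rightarrow> 'a mseries"
  is "\<lambda>f g M. f M + g M" .

lift_definition minus_mseries :: "'a mseries \<Rightarrow> 'a mseries \<Rightarrow> 'a mseries"
  is "\<lambda>f g M. f M - g M" .

lift_definition uminus_mseries :: "'a mseries \<Rightarrow> 'a mseries"
  is "\<lambda>f M. - f M" .

lift_definition times_mseries :: "'a mseries \<Rightarrow> 'a mseries \<Rightarrow> 'a mseries"
  is "\<lambda>f g M. \<Sum>A | A \<subseteq># M. f A * g (M - A)" .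

instance
proof
  fix a b c :: "'a mseries"
  show "a + b + c = a + (b + c)"
    by transfer (simp add: add.assoc)
  show "a + b = b + a"
    by transfer (simp add: add.commute)
  show "0 + a = a"
    by transfer simp
  show "- a + a = 0"
    by transfer simp
  show "a - b = a + - b"
    by transfer simp
  show "(0 :: 'a mseries) \<noteq> 1"
    by transfer (metis zero_neq_one)
  show "(a + b) * c = a * c + b * c"
    by transfer (simp add: distrib_right sum.distrib)
  show "1 * a = a"
  proof (transfer, rule ext)
    fix a :: "nat multiset \<Rightarrow> 'a" and M :: "nat multiset"
    have "(\<Sum>A | A \<subseteq># M. (if A = {#} then 1 else 0) * a (M - A))
        = (\<Sum>A\<in>{{#}}. (if A = {#} then 1 else 0) * a (M - A))"
      by (rule sum.mono_neutral_right) auto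
    then show "(\<Sum>A | A \<subseteq># M. (if A = {#} then 1 else 0) * a (M - A)) = a M"
      by simp
  qed
  show "a * b = b * a"
  proof (transfer, rule ext)
    fix a b :: "nat multiset \<Rightarrow> 'a" and M :: "nat multiset"
    show "(\<Sum>A | A \<subseteq># M. a A * b (M - A)) = (\<Sum>A | A \<subseteq># M. b A * a (M - A))"
      by (rule sum.reindex_bij_witness[where i = "\<lambda>A. M - A" and j = "\<lambda>A. M - A"])
        (auto simp: mult.commute double_diff_mset)
  qed
  show "a * b * c = a * (b * c)"
  proof (transfer, rule ext)
    fix a b c :: "nat multiset \<Rightarrow> 'a" and M :: "nat multiset"
    have aux:
      "B \<subseteq># A \<Longrightarrow> B + (A - B) = A"
      "A \<subseteq># M \<Longrightarrow> B \<subseteq># A \<Longrightarrow> B \<subseteq># M"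
      "A \<subseteq># M \<Longrightarrow> B \<subseteq># A \<Longrightarrow> A - B \<subseteq># M - B"
      "A \<subseteq># M \<Longrightarrow> B \<subseteq># A \<Longrightarrow> M - B - (A - B) = M - A"
      "A \<subseteq># M \<Longrightarrow> B \<subseteq># M - A \<Longrightarrow> A + B \<subseteq># M"
      for A B :: "nat multiset"
      by (auto simp: multiset_eq_iff subseteq_mset_def)
        (metis diff_le_mono le_trans add.commute Nat.le_diff_conv2)+
    have "(\<Sum>A | A \<subseteq># M. (\<Sum>B | B \<subseteq># A. a B * b (A - B)) * c (M - A))
        = (\<Sum>(A, B)\<in>(SIGMA A:{A. A \<subseteq># M}. {B. B \<subseteq># A}). a B * b (A - B) * c (M - A))"
      by (simp add: sum_distrib_right sum.Sigma)
    also have "\<dots> = (\<Sum>(A, B)\<in>(SIGMA A:{A. A \<subseteq># M}. {B. B \<subseteq># M - A}).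
        a A * (b B * c (M - A - B)))"
      by (rule sum.reindex_bij_witness
            [where i = "\<lambda>(A, B). (A + B, A)" and j = "\<lambda>(A, B). (B, A - B)"])
        (auto simp: mult.assoc aux)
    also have "\<dots> = (\<Sum>A | A \<subseteq># M. a A * (\<Sum>B | B \<subseteq># M - A. b B * c (M - A - B)))"
      by (simp add: sum_distrib_left sum.Sigma)
    finally show "(\<Sum>A | A \<subseteq># M. (\<Sum>B | B \<subseteq># A. a B * b (A - B)) * c (M - A))
        = (\<Sum>A | A \<subseteq># M. a A * (\<Sum>B | B \<subseteq># M - A. b B * c (M - A - B)))" .
  qed
qed

end

lift_definition scale :: "'a::comm_ring_1 \<Rightarrow> 'a mseries \<Rightarrow> 'a mseries" (infixr \<open>*\<^sub>S\<close> 75)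
  is "\<lambda>c f M. c * f M" .

text \<open>The variable \<open>x\<^sub>i\<close> (for \<open>i \<ge> 1\<close>) has internal index \<open>i - 1\<close>.\<close>

lift_definition xvar :: "nat \<Rightarrow> 'a::comm_ring_1 mseries"
  is "\<lambda>i M. if M = {#i - 1#} then 1 else 0" .

text \<open>\<open>restrict_vars n f\<close> is \<open>f(x\<^sub>1, \<dots>, x\<^sub>n, 0, 0, \<dots>)\<close>.\<close>

lift_definition restrict_vars :: "nat \<Rightarrow> 'a::comm_ring_1 mseries \<Rightarrow> 'a mseries"
  is "\<lambda>n f M. if set_mset M \<subseteq> {..<n} then f M else 0" .

text \<open>The determinant of \<open>(A i j)\<close> for \<open>1 \<le> i, j \<le> n\<close>; library matrices are indexed from 0.\<close>

definition det1 :: "nat \<Rightarrow> (nat \<Rightarrow> nat \<Rightarrow> 'a::comm_ring_1) \<Rightarrow> 'a" where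
  "det1 n A = det (mat n n (\<lambda>(i, j). A (i + 1) (j + 1)))"


section \<open>Partitions\<close>

typedef partition = "{xs :: nat list. sorted_wrt (\<ge>) xs \<and> 0 \<notin> set xs}"
  morphisms parts Partition
  by (rule exI[of _ "[]"]) simp

definition ell :: "partition \<Rightarrow> nat" where
  "ell lam = length (parts lam)"

text \<open>The \<open>i\<close>-th part for \<open>i \<ge> 1\<close>, which is zero beyond the length.\<close>

definition part :: "partition \<Rightarrow> nat \<Rightarrow> nat" where
  "part lam i = (if 1 \<le> i \<and> i \<le> ell lam then parts lam ! (i - 1) else 0)"


section \<open>Symmetric functions over the field of rational functions in \<open>\<beta>\<close>\<close>

type_synonym scalar = "complex poly fract"

definition beta :: scalar (\<open>\<beta>\<close>) where
  "\<beta> = Fract [:0, 1:] 1"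

definition Sym :: "scalar mseries set" where
  "Sym = {f. (\<forall>\<sigma> M. bij \<sigma> \<longrightarrow> mcoeff f (image_mset \<sigma> M) = mcoeff f M) \<and>
             (\<exists>d. \<forall>M. size M > d \<longrightarrow> mcoeff f M = 0)}"

text \<open>
  Every monomial of degree \<open>m\<close> has coefficient one; in particular \<open>hsym 0 = 1\<close>, and
  \<open>hsym m = 0\<close> for negative \<open>m\<close>.
\<close>

definition hsym :: "int \<Rightarrow> scalar mseries" where
  "hsym m = MSeries (\<lambda>M. if int (size M) = m then 1 else 0)"

definition vandermonde :: "nat \<Rightarrow> scalar mseries" where
  "vandermonde n = (\<Prod>j\<in>{1..n}. \<Prod>i\<in>{1..<j}. xvar i - xvar j)"

text \<open>
  Schur functions are the stable limits of the bialternant quotients. Here and for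
  \<open>groth\<close> below, a quotient by the Vandermonde product is expressed by multiplying it out;
  the ring of series over a field has no zero divisors.
\<close>

definition schur :: "partition \<Rightarrow> scalar mseries" where
  "schur lam = (THE f. f \<in> Sym \<and>
     (\<forall>n\<ge>ell lam. restrict_vars n f * vandermonde n
        = det1 n (\<lambda>i j. xvar i ^ (part lam j + n - j))))"

definition schur_coeff :: "scalar mseries \<Rightarrow> partition \<Rightarrow> scalar" where
  "schur_coeff f = (THE c. finite {\<nu>. c \<nu> \<noteq> 0} \<and> f = (\<Sum>\<nu> | c \<nu> \<noteq> 0. c \<nu> *\<^sub>S schur \<nu>))"


section \<open>The completion and the Hall pairing\<close>

text \<open>A formal sum \<open>\<Sum> c\<^sub>\<nu> s\<^sub>\<nu>\<close> in the completion is represented by its coefficient function.\<close>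

definition Sym_hat :: "(partition \<Rightarrow> scalar) set" where
  "Sym_hat = {c. \<forall>n. finite {\<nu>. ell \<nu> \<le> n \<and> c \<nu> \<noteq> 0}}"

text \<open>
  The value of a formal sum at \<open>(x\<^sub>1, \<dots>, x\<^sub>n)\<close>: the terms with \<open>ell \<nu> > n\<close> vanish there.
\<close>

definition hat_eval :: "nat \<Rightarrow> (partition \<Rightarrow> scalar) \<Rightarrow> scalar mseries" where
  "hat_eval n c = (\<Sum>\<nu> | ell \<nu> \<le> n \<and> c \<nu> \<noteq> 0. c \<nu> *\<^sub>S restrict_vars n (schur \<nu>))"

definition hall_hat :: "(partition \<Rightarrow> scalar) \<Rightarrow> scalar mseries \<Rightarrow> scalar" where
  "hall_hat c g = (\<Sum>\<nu> | schur_coeff g \<nu> \<noteq> 0. c \<nu> * schur_coeff g \<nu>)"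

definition hall :: "scalar mseries \<Rightarrow> scalar mseries \<Rightarrow> scalar" where
  "hall f g = hall_hat (schur_coeff f) g"

definition perp :: "scalar mseries \<Rightarrow> scalar mseries \<Rightarrow> scalar mseries" where
  "perp f g = (THE p. p \<in> Sym \<and> (\<forall>h\<in>Sym. hall p h = hall g (f * h)))"


section \<open>Stable Grothendieck polynomials, their duals and truncations\<close>

definition groth :: "partition \<Rightarrow> partition \<Rightarrow> scalar" where
  "groth lam = (THE c. c \<in> Sym_hat \<and>
     (\<forall>n\<ge>ell lam. hat_eval n c * vandermonde n
        = det1 n (\<lambda>i j. xvar i ^ (part lam j + n - j) * (1 + \<beta> *\<^sub>S xvar i) ^ (j - 1))))"

definition dual_groth :: "partition \<Rightarrow> scalar mseries" where
  "dual_groth mu = (THE g. g \<in> Sym \<and>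
     (\<forall>lam. hall_hat (groth lam) g = (if lam = mu then 1 else 0)))"

text \<open>
  The linear map from symmetric polynomials in \<open>x\<^sub>1, \<dots>, x\<^sub>r\<close> to symmetric functions with
  \<open>s\<^sub>\<nu>(x\<^sub>1, \<dots>, x\<^sub>r) \<mapsto> s\<^sub>\<nu>\<close> for \<open>ell \<nu> \<le> r\<close>.
\<close>

definition iota :: "nat \<Rightarrow> scalar mseries \<Rightarrow> scalar mseries" where
  "iota r p = (THE f. \<exists>c. finite {\<nu>. c \<nu> \<noteq> 0} \<and> (\<forall>\<nu>. c \<nu> \<noteq> 0 \<longrightarrow> ell \<nu> \<le> r) \<and>
     p = (\<Sum>\<nu> | c \<nu> \<noteq> 0. c \<nu> *\<^sub>S restrict_vars r (schur \<nu>)) \<and>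
     f = (\<Sum>\<nu> | c \<nu> \<noteq> 0. c \<nu> *\<^sub>S schur \<nu>))"

definition groth_trunc :: "nat \<Rightarrow> partition \<Rightarrow> scalar mseries" where
  "groth_trunc r lam = iota r (hat_eval r (groth lam))"


section \<open>Binomial coefficients with integer arguments\<close>

text \<open>The division is exact, since \<open>n!\<close> divides any product of \<open>n\<close> consecutive integers.\<close>

definition zbinom :: "int \<Rightarrow> int \<Rightarrow> int" where
  "zbinom a n = (if n < 0 then 0 else (\<Prod>i<nat n. a - int i) div fact (nat n))"

end

theory Submission
  imports Defs "HOL-Computational_Algebra.Formal_Power_Series"
begin

text \<open>
  Let \<open>D\<close> be the Vandermonde determinant in \<open>r\<close> variables. The Jacobi--Trudi identity holds for
  arbitrary alternants: if the columns of a matrix are given by one-variable polynomials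
  \<open>p\<^sub>1, \<dots>, p\<^sub>r\<close>, then \<open>det (p\<^sub>j(x\<^sub>i)) / D\<close> is the determinant obtained by replacing powers of \<open>x\<^sub>i\<close>
  by complete symmetric functions. This writes the truncation of \<open>G\<^sub>\<lambda>\<close> and a candidate for \<open>g\<^sub>\<mu>\<close> as
  determinants in the \<open>h\<^sub>m\<close>; the candidate comes from columns whose coefficients are binomials of
  \<open>-j\<close> in place of the binomials of \<open>j\<close> that occur in \<open>G\<^sub>\<lambda>\<close> (\<open>j\<close> counted from 0).

  Pairing a product of \<open>r\<close> complete symmetric functions with \<open>F\<close> extracts a coefficient of \<open>F\<close> in
  \<open>r\<close> variables. Hence both sides of the adjunction \<open>\<langle>det, h\<rangle> = \<langle>G\<^sup>r\<^sub>\<lambda>, g\<^sub>\<mu> h\<rangle>\<close>, where \<open>det\<close> is the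
  determinant of the proposition, are the same linear combination of coefficients of
  \<open>g\<^sub>\<mu> h D\<close>. For \<open>h = 1\<close> the left-hand side is the determinant of the constant terms, which the
  Vandermonde convolution reduces to binomials of \<open>i - j\<close> and which equals \<open>\<delta>\<^sub>\<lambda>\<^sub>\<mu>\<close>; so the candidate
  is indeed the dual stable Grothendieck polynomial.
\<close>


section \<open>Monomials and coefficients\<close>

lemmas mcoeff_simps [simp] = zero_mseries.rep_eq one_mseries.rep_eq plus_mseries.rep_eq
  minus_mseries.rep_eq uminus_mseries.rep_eq scale.rep_eq

lemma mcoeff_sum [simp]: "mcoeff (sum f A) M = (\<Sum>a\<in>A. mcoeff (f a) M)"
  by (induction A rule: infinite_finite_induct) auto

lemma mcoeff_MSeries [simp]: "mcoeff (MSeries f) M = f M"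
  by (simp add: MSeries_inverse)

lemma scale_mult_left: "(c *\<^sub>S f) * g = c *\<^sub>S (f * g)"
  by (rule mseries_eqI) (simp add: times_mseries.rep_eq sum_distrib_left mult.assoc)

lemma scale_mult_right: "f * (c *\<^sub>S g) = c *\<^sub>S (f * g)"
  by (simp add: scale_mult_left mult.commute[of f])

lemma scale_scale [simp]: "c *\<^sub>S d *\<^sub>S f = (c * d) *\<^sub>S f"
  by (rule mseries_eqI) (simp add: mult.assoc)

lemma scale_one [simp]: "1 *\<^sub>S f = f"
  by (rule mseries_eqI) simp

lemma scale_zero_left [simp]: "0 *\<^sub>S f = 0"
  by (rule mseries_eqI) simp

lemma scale_zero_right [simp]: "c *\<^sub>S 0 = 0"
  by (rule mseries_eqI) simp

lemma scale_add_right: "c *\<^sub>S (f + g) = c *\<^sub>S f + c *\<^sub>S g"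
  by (rule mseries_eqI) (simp add: distrib_left)

lemma scale_sum_right: "c *\<^sub>S sum f A = (\<Sum>a\<in>A. c *\<^sub>S f a)"
  by (induction A rule: infinite_finite_induct) (auto simp: scale_add_right)

lemma prod_scale: "(\<Prod>a\<in>A. c a *\<^sub>S f a) = (\<Prod>a\<in>A. c a) *\<^sub>S (\<Prod>a\<in>A. f a)"
  by (induction A rule: infinite_finite_induct)
    (auto simp: scale_mult_left scale_mult_right mult.commute)

lemma mcoeff_of_int_mult [simp]: "mcoeff (of_int k * f) M = of_int k * mcoeff f M"
proof -
  have "mcoeff (of_nat m * f) M = of_nat m * mcoeff f M" for m
    by (induction m) (simp_all add: distrib_right)
  then show ?thesis
    by (cases k rule: int_cases2) simp_all
qed

definition mono_series :: "nat multiset \<Rightarrow> 'a::comm_ring_1 mseries" where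
  "mono_series M = MSeries (\<lambda>N. if N = M then 1 else 0)"

lemma mcoeff_mult_mon:
  "mcoeff (f * mono_series M) N = (if M \<subseteq># N then mcoeff f (N - M) else 0)"
proof (cases "M \<subseteq># N")
  case True
  have "mcoeff (f * mono_series M) N = (\<Sum>A\<in>{N - M}. mcoeff f A * (if N - A = M then 1 else 0))"
    unfolding times_mseries.rep_eq mono_series_def mcoeff_MSeries
    by (rule sum.mono_neutral_right) (auto simp: double_diff_mset)
  then show ?thesis using True by (simp add: double_diff_mset)
next
  case False
  then show ?thesis
    unfolding times_mseries.rep_eq mono_series_def mcoeff_MSeries
    by (auto intro!: sum.neutral)
qed

lemma mon_empty: "mono_series {#} = 1"
  by (rule mseries_eqI) (simp add: mono_series_def)

lemma mon_add: "mono_series (A + B) = mono_series A * mono_series B"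
proof (rule mseries_eqI)
  fix N
  show "mcoeff (mono_series (A + B)) N = mcoeff (mono_series A * mono_series B) N"
    unfolding mcoeff_mult_mon
    by (auto simp: mono_series_def subset_mset.add_diff_inverse)
qed

lemma xvar_eq_mon: "xvar (Suc i) = mono_series {#i#}"
  by (rule mseries_eqI) (simp add: xvar.rep_eq mono_series_def)

lemma xvar_power_eq_mon: "xvar (Suc i) ^ k = mono_series (replicate_mset k i)"
  by (induction k) (simp_all add: mon_empty xvar_eq_mon flip: mon_add)

definition expo :: "nat \<Rightarrow> (nat \<Rightarrow> nat) \<Rightarrow> nat multiset" where
  "expo n a = (\<Sum>i<n. replicate_mset (a i) i)"

lemma count_expo: "count (expo n a) i = (if i < n then a i else 0)"
  unfolding expo_def by (induction n) auto

lemma size_expo: "size (expo n a) = (\<Sum>i<n. a i)"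
  unfolding expo_def by (induction n) auto

lemma expo_cong: "(\<And>i. i < n \<Longrightarrow> a i = b i) \<Longrightarrow> expo n a = expo n b"
  by (rule multiset_eqI) (simp add: count_expo)

lemma prod_xvar_power: "(\<Prod>i<n. xvar (Suc i) ^ a i) = mono_series (expo n a)"
  unfolding expo_def by (induction n) (simp_all add: mon_empty xvar_power_eq_mon mon_add)

lemma set_mset_expo: "set_mset (expo n a) \<subseteq> {..<n}"
  by (auto simp: count_expo simp flip: count_greater_zero_iff split: if_splits)

lemma expo_count: "set_mset M \<subseteq> {..<n} \<Longrightarrow> expo n (count M) = M"
  by (rule multiset_eqI) (auto simp: count_expo not_in_iff[symmetric])

lemma restrict_vars_add: "restrict_vars n (f + g) = restrict_vars n f + restrict_vars n g"
  by (rule mseries_eqI) (simp add: restrict_vars.rep_eq)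

lemma restrict_vars_diff: "restrict_vars n (f - g) = restrict_vars n f - restrict_vars n g"
  by (rule mseries_eqI) (simp add: restrict_vars.rep_eq)

lemma restrict_vars_scale: "restrict_vars n (c *\<^sub>S f) = c *\<^sub>S restrict_vars n f"
  by (rule mseries_eqI) (simp add: restrict_vars.rep_eq)

lemma restrict_vars_zero [simp]: "restrict_vars n 0 = 0"
  by (rule mseries_eqI) (simp add: restrict_vars.rep_eq)

lemma restrict_vars_one [simp]: "restrict_vars n 1 = 1"
  by (rule mseries_eqI) (simp add: restrict_vars.rep_eq)

lemma restrict_vars_mult: "restrict_vars n (f * g) = restrict_vars n f * restrict_vars n g"
proof (rule mseries_eqI)
  fix M
  show "mcoeff (restrict_vars n (f * g)) M = mcoeff (restrict_vars n f * restrict_vars n g) M"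
  proof (cases "set_mset M \<subseteq> {..<n}")
    case True
    then have "set_mset A \<subseteq> {..<n} \<and> set_mset (M - A) \<subseteq> {..<n}" if "A \<subseteq># M" for A
      using that by (meson in_diffD set_mset_mono subset_iff)
    then show ?thesis
      using True by (simp add: restrict_vars.rep_eq times_mseries.rep_eq)
  next
    case False
    have "mcoeff (restrict_vars n f) A * mcoeff (restrict_vars n g) (M - A) = 0"
      if "A \<subseteq># M" for A
    proof -
      have "set_mset M = set_mset A \<union> set_mset (M - A)"
        using that by (metis set_mset_union subset_mset.add_diff_inverse)
      with False show ?thesis by (auto simp: restrict_vars.rep_eq)
    qed
    then have "mcoeff (restrict_vars n f * restrict_vars n g) M = 0"
      unfolding times_mseries.rep_eq by (intro sum.neutral) simp
    with False show ?thesis by (simp add: restrict_vars.rep_eq)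
  qed
qed

lemma restrict_vars_sum: "restrict_vars n (sum f A) = (\<Sum>a\<in>A. restrict_vars n (f a))"
  by (induction A rule: infinite_finite_induct) (auto simp: restrict_vars_add)

lemma restrict_vars_prod: "restrict_vars n (prod f A) = (\<Prod>a\<in>A. restrict_vars n (f a))"
  by (induction A rule: infinite_finite_induct) (auto simp: restrict_vars_mult)

lemma restrict_vars_restrict_vars:
  "m \<le> n \<Longrightarrow> restrict_vars m (restrict_vars n f) = restrict_vars m f"
  by (rule mseries_eqI) (auto simp: restrict_vars.rep_eq)

lemma restrict_vars_xvar:
  "restrict_vars n (xvar (Suc i)) = (if i < n then xvar (Suc i) else 0)"
  by (rule mseries_eqI) (auto simp: restrict_vars.rep_eq xvar.rep_eq)

text \<open>Negative exponents are allowed, so that exponents can be shifted freely; their coefficient is 0.\<close>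

definition cf :: "nat \<Rightarrow> 'a::comm_ring_1 mseries \<Rightarrow> (nat \<Rightarrow> int) \<Rightarrow> 'a" where
  "cf n f \<alpha> = (if \<forall>i<n. 0 \<le> \<alpha> i then mcoeff f (expo n (\<lambda>i. nat (\<alpha> i))) else 0)"

lemma cf_cong: "(\<And>i. i < n \<Longrightarrow> \<alpha> i = \<alpha>' i) \<Longrightarrow> cf n f \<alpha> = cf n f \<alpha>'"
  unfolding cf_def by (auto intro: arg_cong[OF expo_cong])

lemma cf_nat: "cf n f (\<lambda>i. int (a i)) = mcoeff f (expo n a)"
  by (auto simp: cf_def)

lemma cf_zero [simp]: "cf n 0 \<alpha> = 0"
  by (auto simp: cf_def)

lemma cf_add: "cf n (f + g) \<alpha> = cf n f \<alpha> + cf n g \<alpha>"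
  by (auto simp: cf_def)

lemma cf_diff: "cf n (f - g) \<alpha> = cf n f \<alpha> - cf n g \<alpha>"
  by (auto simp: cf_def)

lemma cf_scale: "cf n (c *\<^sub>S f) \<alpha> = c * cf n f \<alpha>"
  by (auto simp: cf_def)

lemma cf_sum: "cf n (sum f A) \<alpha> = (\<Sum>a\<in>A. cf n (f a) \<alpha>)"
  by (induction A rule: infinite_finite_induct) (auto simp: cf_add)

lemma cf_of_int_mult: "cf n (of_int k * f) \<alpha> = of_int k * cf n f \<alpha>"
  by (auto simp: cf_def)

lemma cf_restrict_vars [simp]: "cf n (restrict_vars n f) \<alpha> = cf n f \<alpha>"
  using set_mset_expo by (auto simp: cf_def restrict_vars.rep_eq)

lemma restrict_vars_eqI:
  assumes "\<And>\<alpha>. cf n f \<alpha> = cf n g \<alpha>"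
  shows "restrict_vars n f = restrict_vars n g"
proof (rule mseries_eqI)
  fix M
  show "mcoeff (restrict_vars n f) M = mcoeff (restrict_vars n g) M"
  proof (cases "set_mset M \<subseteq> {..<n}")
    case True
    then show ?thesis
      using assms[of "\<lambda>i. int (count M i)"] by (simp add: cf_nat expo_count restrict_vars.rep_eq)
  qed (simp add: restrict_vars.rep_eq)
qed

lemma cf_mult_mon:
  "cf n (f * (\<Prod>i<n. xvar (Suc i) ^ g i)) \<alpha> = cf n f (\<lambda>i. \<alpha> i - int (g i))"
proof (cases "\<forall>i<n. int (g i) \<le> \<alpha> i")
  case True
  then have nonneg: "\<forall>i<n. 0 \<le> \<alpha> i"
    by (meson of_nat_0_le_iff order_trans)
  have "expo n g \<subseteq># expo n (\<lambda>i. nat (\<alpha> i))"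
    using True by (auto simp: subseteq_mset_def count_expo)
  moreover have "expo n (\<lambda>i. nat (\<alpha> i)) - expo n g = expo n (\<lambda>i. nat (\<alpha> i - int (g i)))"
    by (rule multiset_eqI) (auto simp: count_expo nat_diff_distrib')
  ultimately show ?thesis
    using True nonneg by (simp add: cf_def prod_xvar_power mcoeff_mult_mon)
next
  case False
  then obtain i where i: "i < n" "\<alpha> i < int (g i)" by force
  have "\<not> expo n g \<subseteq># expo n (\<lambda>i. nat (\<alpha> i))" if "\<forall>i<n. 0 \<le> \<alpha> i"
  proof
    assume "expo n g \<subseteq># expo n (\<lambda>i. nat (\<alpha> i))"
    then have "g i \<le> nat (\<alpha> i)" using i(1) by (auto simp: subseteq_mset_def count_expo dest: spec[of _ i])
    with i that show False by auto
  qed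
  moreover have "\<not> (\<forall>i<n. 0 \<le> \<alpha> i - int (g i))" using i by auto
  ultimately show ?thesis
    by (auto simp: cf_def prod_xvar_power mcoeff_mult_mon)
qed

lemma cf_prod_scale_mult:
  "cf n (f * (\<Prod>i<n. c i *\<^sub>S xvar (Suc i) ^ g i)) \<alpha>
    = (\<Prod>i<n. c i) * cf n f (\<lambda>i. \<alpha> i - int (g i))"
  by (simp add: prod_scale scale_mult_right cf_scale cf_mult_mon)

text \<open>Each \<open>x\<^sub>i - x\<^sub>j\<close> is a non zero divisor: \<open>f (x\<^sub>i - x\<^sub>j) = 0\<close> says that a coefficient of \<open>f\<close>
  is unchanged when an \<open>x\<^sub>j\<close> is traded for an \<open>x\<^sub>i\<close>, and vanishes where there is no \<open>x\<^sub>j\<close> left.\<close>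

lemma xvar_diff_cancel:
  fixes f :: "'a::comm_ring_1 mseries"
  assumes "i \<noteq> j" and "f * (xvar (Suc i) - xvar (Suc j)) = 0"
  shows "f = 0"
proof -
  have trade: "mcoeff f M = (if j \<in># M then mcoeff f (add_mset i M - {#j#}) else 0)" for M
  proof -
    have "mcoeff (f * mono_series {#i#} - f * mono_series {#j#}) (add_mset i M) = 0"
      using assms(2) by (simp add: right_diff_distrib xvar_eq_mon)
    then show ?thesis
      using assms(1) by (auto simp: mcoeff_mult_mon split: if_splits)
  qed
  have "count M j = k \<Longrightarrow> mcoeff f M = 0" for k M
  proof (induction k arbitrary: M)
    case 0
    then show ?case using trade[of M] by (simp add: count_eq_zero_iff)
  next
    case (Suc k)
    then have "count (add_mset i M - {#j#}) j = k" using assms(1) by simp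
    then show ?case by (subst trade) (simp only: Suc.IH if_cancel)
  qed
  then show ?thesis by (intro mseries_eqI) simp
qed

lemma mult_prod_cancel:
  fixes f :: "'a::comm_ring_1"
  assumes "finite A" and "\<And>a f. a \<in> A \<Longrightarrow> f * p a = 0 \<Longrightarrow> f = 0" and "f * prod p A = 0"
  shows "f = 0"
  using assms
proof (induction A arbitrary: f rule: finite_induct)
  case (insert a A)
  from insert.prems(2) insert.hyps have "(f * p a) * prod p A = 0" by (simp add: mult.assoc)
  with insert.IH[of "f * p a"] insert.prems(1) have "f * p a = 0" by blast
  with insert.prems(1) show ?case by blast
qed simp

lemma vandermonde_cancel_zero:
  assumes "f * vandermonde n = 0"
  shows "f = 0"
proof -
  have zero: "f = 0" if "f * (xvar i - xvar j) = 0" "i \<in> {1..<j}" for f :: "scalar mseries" and i j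
    using xvar_diff_cancel[of "i - 1" "j - 1" f] that by auto
  have "f = 0" if "f * (\<Prod>i\<in>{1..<j}. xvar i - xvar j) = 0" for f :: "scalar mseries" and j
    by (rule mult_prod_cancel[OF _ _ that]) (use zero in auto)
  then show ?thesis
    using mult_prod_cancel[OF _ _ assms[unfolded vandermonde_def]] by blast
qed

lemma vandermonde_cancel: "f * vandermonde n = g * vandermonde n \<Longrightarrow> f = g"
  using vandermonde_cancel_zero[of "f - g" n] by (simp add: left_diff_distrib)


section \<open>Determinants\<close>

definition dt :: "nat \<Rightarrow> (nat \<Rightarrow> nat \<Rightarrow> 'a::comm_ring_1) \<Rightarrow> 'a" where
  "dt n A = det (mat n n (\<lambda>(i, j). A i j))"

lemma dt_eq_sum:
  "dt n A = (\<Sum>p | p permutes {..<n}. signof p * (\<Prod>i<n. A i (p i)))"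
proof -
  have "p i < n" if "p permutes {..<n}" "i < n" for p :: "nat \<Rightarrow> nat" and i
    using permutes_in_image[OF that(1), of i] that(2) by simp
  then show ?thesis
    unfolding dt_def by (subst det_def'[of _ n]) (auto simp: atLeast0LessThan intro!: sum.cong prod.cong)
qed

lemma dt_cong: "(\<And>i j. i < n \<Longrightarrow> j < n \<Longrightarrow> A i j = B i j) \<Longrightarrow> dt n A = dt n B"
  unfolding dt_def by (intro arg_cong[of _ _ det] eq_matI) auto

lemma dt_transpose: "dt n (\<lambda>i j. A j i) = dt n A"
proof -
  have "dt n (\<lambda>i j. A j i) = det (transpose_mat (mat n n (\<lambda>(i, j). A i j)))"
    unfolding dt_def by (intro arg_cong[of _ _ det] eq_matI) auto
  then show ?thesis
    unfolding dt_def by (subst (asm) det_transpose[of _ n]) auto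
qed

lemma dt_mult: "dt n (\<lambda>i j. \<Sum>k<n. A i k * B k j) = dt n A * dt n B"
proof -
  have "mat n n (\<lambda>(i, j). \<Sum>k<n. A i k * B k j) = mat n n (\<lambda>(i, j). A i j) * mat n n (\<lambda>(i, j). B i j)"
    by (rule eq_matI) (auto simp: scalar_prod_def atLeast0LessThan)
  then show ?thesis
    unfolding dt_def by (simp add: det_mult[of _ n])
qed

lemma dt_upper_triangular:
  assumes "\<And>i j. i < n \<Longrightarrow> j < i \<Longrightarrow> A i j = 0"
  shows "dt n A = (\<Prod>i<n. A i i)"
  unfolding dt_def
  by (subst det_upper_triangular[of _ n])
    (use assms in \<open>auto simp: prod_list_diag_prod atLeast0LessThan\<close>)

lemma dt_lower_triangular:
  assumes "\<And>i j. j < n \<Longrightarrow> i < j \<Longrightarrow> A i j = 0"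
  shows "dt n A = (\<Prod>i<n. A i i)"
  using dt_upper_triangular[of n "\<lambda>i j. A j i"] assms unfolding dt_transpose[of _ A] by simp

lemma dt_last_column:
  assumes "\<And>i. i < n \<Longrightarrow> A i n = 0"
  shows "dt (Suc n) A = A n n * dt n A"
proof -
  have "mat_delete (mat (Suc n) (Suc n) (\<lambda>(i, j). A i j)) n n = mat n n (\<lambda>(i, j). A i j)"
    by (rule eq_matI) (auto simp: mat_delete_def)
  then show ?thesis
    unfolding dt_def using assms
    by (subst laplace_expansion_column[of _ "Suc n" n]) (auto simp: cofactor_def)
qed

lemma dt_last_row:
  assumes "\<And>j. j < n \<Longrightarrow> A n j = 0"
  shows "dt (Suc n) A = A n n * dt n A"
  using dt_last_column[of n "\<lambda>i j. A j i"] assms unfolding dt_transpose[of _ A] by simp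

lemma dt_scale_rows: "dt n (\<lambda>i j. c i * A i j) = (\<Prod>i<n. c i) * dt n A"
  unfolding dt_eq_sum by (simp add: prod.distrib sum_distrib_left mult_ac)

lemma det1_eq_dt: "det1 n A = dt n (\<lambda>i j. A (Suc i) (Suc j))"
  by (simp add: det1_def dt_def)

lemma restrict_vars_of_int_mult: "restrict_vars n (of_int k * f) = of_int k * restrict_vars n f"
  by (rule mseries_eqI) (simp add: restrict_vars.rep_eq)

lemma restrict_vars_dt: "restrict_vars m (dt n A) = dt n (\<lambda>i j. restrict_vars m (A i j))"
  unfolding dt_eq_sum by (simp add: restrict_vars_sum restrict_vars_of_int_mult restrict_vars_prod)


lemma power_newton_expansion:
  fixes y :: "nat \<Rightarrow> 'a::comm_ring_1"
  assumes "e < n"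
  shows "\<exists>c. c (n - 1 - e) = 1 \<and> (\<forall>k<n - 1 - e. c k = 0) \<and>
    (\<forall>z. z ^ e = (\<Sum>k<n. c k * (\<Prod>s\<in>{k<..<n}. z - y s)))"
  using assms
proof (induction e)
  case 0
  define c :: "nat \<Rightarrow> 'a" where "c = (\<lambda>k. if k = n - 1 then 1 else 0)"
  have "(\<Sum>k<n. c k * (\<Prod>s\<in>{k<..<n}. z - y s)) = (\<Sum>k\<in>{n - 1}. c k * (\<Prod>s\<in>{k<..<n}. z - y s))" for z
    using 0 by (intro sum.mono_neutral_right) (auto simp: c_def)
  moreover have "{n - 1<..<n} = {}" by auto
  ultimately show ?case
    by (intro exI[of _ c]) (auto simp: c_def)
next
  case (Suc e)
  then obtain c where c: "c (n - 1 - e) = 1" "\<And>k. k < n - 1 - e \<Longrightarrow> c k = 0"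
    and ex: "\<And>z. z ^ e = (\<Sum>k<n. c k * (\<Prod>s\<in>{k<..<n}. z - y s))"
    by auto
  define N where "N = (\<lambda>z k. \<Prod>s\<in>{k<..<n}. z - y s)"
  define c' where "c' = (\<lambda>k. (if Suc k < n then c (Suc k) else 0) + y k * c k)"
  have c0: "c 0 = 0" using Suc.prems by (intro c(2)) auto
  obtain m where m: "n = Suc m" using Suc.prems by (cases n) auto
  have "z ^ Suc e = (\<Sum>k<n. c' k * N z k)" for z
  proof -
    have step: "N z k * z = N z (k - 1) + y k * N z k" if "k < n" "0 < k" for k
    proof -
      have "{k - 1<..<n} = insert k {k<..<n}" using that by auto
      then have "N z (k - 1) = (z - y k) * N z k" by (simp add: N_def)
      then show ?thesis by (simp add: algebra_simps)
    qed
    have "z ^ Suc e = (\<Sum>k<n. c k * (N z k * z))"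
      unfolding power_Suc2 ex[of z] N_def by (simp add: sum_distrib_right mult.assoc)
    also have "\<dots> = (\<Sum>k<n. (if k = 0 then 0 else c k * N z (k - 1)) + y k * c k * N z k)"
    proof (rule sum.cong[OF refl])
      fix k assume "k \<in> {..<n}"
      then show "c k * (N z k * z) = (if k = 0 then 0 else c k * N z (k - 1)) + y k * c k * N z k"
        using c0 step[of k] by (cases "k = 0") (simp_all add: distrib_left mult_ac)
    qed
    also have "\<dots> = (\<Sum>k<n. if k = 0 then 0 else c k * N z (k - 1)) + (\<Sum>k<n. y k * c k * N z k)"
      by (rule sum.distrib)
    also have "(\<Sum>k<n. if k = 0 then 0 else c k * N z (k - 1)) = (\<Sum>k<m. c (Suc k) * N z k)"
      unfolding m by (subst sum.lessThan_Suc_shift) simp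
    also have "\<dots> = (\<Sum>k<n. (if Suc k < n then c (Suc k) else 0) * N z k)"
      unfolding m by simp
    finally show ?thesis
      by (simp add: c'_def distrib_right sum.distrib)
  qed
  moreover have "c' (n - 1 - Suc e) = 1"
  proof -
    have "Suc (n - 1 - Suc e) = n - 1 - e" "n - 1 - Suc e < n - 1 - e" using Suc.prems by auto
    then show ?thesis using c Suc.prems by (simp add: c'_def)
  qed
  moreover have "c' k = 0" if "k < n - 1 - Suc e" for k
    using c(2)[of k] c(2)[of "Suc k"] that by (simp add: c'_def)
  ultimately show ?case
    unfolding N_def by (intro exI[of _ c'] conjI allI impI)
qed

lemma dt_vandermonde:
  fixes y :: "nat \<Rightarrow> 'a::comm_ring_1"
  shows "dt n (\<lambda>i j. y i ^ (n - 1 - j)) = (\<Prod>i<n. \<Prod>s\<in>{i<..<n}. y i - y s)"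
proof -
  have "\<forall>e\<in>{..<n}. \<exists>c. c (n - 1 - e) = 1 \<and> (\<forall>k<n - 1 - e. c k = 0) \<and>
    (\<forall>z. z ^ e = (\<Sum>k<n. c k * (\<Prod>s\<in>{k<..<n}. z - y s)))"
    using power_newton_expansion[of _ n y] by simp
  from bchoice[OF this] obtain c where all: "\<forall>e\<in>{..<n}. c e (n - 1 - e) = 1 \<and>
      (\<forall>k<n - 1 - e. c e k = 0) \<and> (\<forall>z. z ^ e = (\<Sum>k<n. c e k * (\<Prod>s\<in>{k<..<n}. z - y s)))" ..
  have c: "\<And>e. e < n \<Longrightarrow> c e (n - 1 - e) = 1" "\<And>e k. e < n \<Longrightarrow> k < n - 1 - e \<Longrightarrow> c e k = 0"
    and ex: "\<And>e z. e < n \<Longrightarrow> z ^ e = (\<Sum>k<n. c e k * (\<Prod>s\<in>{k<..<n}. z - y s))"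
    using all by (simp_all only: lessThan_iff Ball_def)
  have "dt n (\<lambda>i j. y i ^ (n - 1 - j))
      = dt n (\<lambda>i j. \<Sum>k<n. (\<Prod>s\<in>{k<..<n}. y i - y s) * c (n - 1 - j) k)"
    by (rule dt_cong) (use ex in \<open>simp add: mult.commute\<close>)
  also have "\<dots> = dt n (\<lambda>i k. \<Prod>s\<in>{k<..<n}. y i - y s) * dt n (\<lambda>k j. c (n - 1 - j) k)"
    by (rule dt_mult)
  also have "dt n (\<lambda>i k. \<Prod>s\<in>{k<..<n}. y i - y s) = (\<Prod>i<n. \<Prod>s\<in>{i<..<n}. y i - y s)"
    by (rule dt_upper_triangular) (auto intro!: prod_zero)
  also have "dt n (\<lambda>k j. c (n - 1 - j) k) = (\<Prod>i<n. c (n - 1 - i) i)"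
    by (rule dt_lower_triangular) (auto intro!: c(2))
  also have "\<dots> = 1"
  proof (rule prod.neutral, rule ballI)
    fix i assume "i \<in> {..<n}"
    then have "n - 1 - (n - 1 - i) = i" by auto
    then show "c (n - 1 - i) i = 1" using c(1)[of "n - 1 - i"] \<open>i \<in> _\<close> by simp
  qed
  finally show ?thesis by simp
qed

lemma vandermonde_eq_dt: "vandermonde n = dt n (\<lambda>i j. xvar (Suc i) ^ (n - 1 - j))"
proof -
  let ?g = "\<lambda>i j. xvar i - xvar j :: scalar mseries"
  have "vandermonde n = (\<Prod>(j, i)\<in>(SIGMA j:{1..n}. {1..<j}). ?g i j)"
    unfolding vandermonde_def by (simp add: prod.Sigma)
  also have "\<dots> = (\<Prod>(i, s)\<in>(SIGMA i:{..<n}. {i<..<n}). ?g (Suc i) (Suc s))"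
    by (rule prod.reindex_bij_witness[where i = "\<lambda>(i, s). (Suc s, Suc i)" and j = "\<lambda>(j, i). (i - 1, j - 1)"])
      auto
  also have "\<dots> = (\<Prod>i<n. \<Prod>s\<in>{i<..<n}. ?g (Suc i) (Suc s))"
    by (simp add: prod.Sigma)
  finally show ?thesis by (simp only: dt_vandermonde)
qed


section \<open>Symmetric functions\<close>

lemma SymI:
  assumes "\<And>\<sigma> M. bij \<sigma> \<Longrightarrow> mcoeff f (image_mset \<sigma> M) = mcoeff f M"
    and "\<And>M. d < size M \<Longrightarrow> mcoeff f M = 0"
  shows "f \<in> Sym"
  using assms unfolding Sym_def by blast

lemma Sym_image_mset: "f \<in> Sym \<Longrightarrow> bij \<sigma> \<Longrightarrow> mcoeff f (image_mset \<sigma> M) = mcoeff f M"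
  unfolding Sym_def by blast

lemma Sym_degree_bound:
  assumes "f \<in> Sym"
  obtains d where "\<And>M. d < size M \<Longrightarrow> mcoeff f M = 0"
  using assms unfolding Sym_def by blast

lemma Sym_zero [simp]: "0 \<in> Sym"
  by (rule SymI[where d = 0]) simp_all

lemma Sym_one [simp]: "1 \<in> Sym"
  by (rule SymI[where d = 0]) auto

lemma Sym_scale:
  assumes "f \<in> Sym"
  shows "c *\<^sub>S f \<in> Sym"
proof -
  obtain d where "\<And>M. d < size M \<Longrightarrow> mcoeff f M = 0"
    using Sym_degree_bound[OF assms] by blast
  then show ?thesis
    using assms by (intro SymI[where d = d]) (auto simp: Sym_image_mset)
qed

lemma Sym_add:
  assumes "f \<in> Sym" "g \<in> Sym"
  shows "f + g \<in> Sym"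
proof -
  obtain d where "\<And>M. d < size M \<Longrightarrow> mcoeff f M = 0"
    using Sym_degree_bound[OF assms(1)] by blast
  moreover obtain e where "\<And>M. e < size M \<Longrightarrow> mcoeff g M = 0"
    using Sym_degree_bound[OF assms(2)] by blast
  ultimately show ?thesis
    using assms by (intro SymI[where d = "max d e"]) (auto simp: Sym_image_mset)
qed

lemma Sym_uminus:
  assumes "f \<in> Sym"
  shows "- f \<in> Sym"
proof -
  have "- f = (- 1) *\<^sub>S f" by (rule mseries_eqI) simp
  with Sym_scale[OF assms] show ?thesis by metis
qed

lemma Sym_diff: "f \<in> Sym \<Longrightarrow> g \<in> Sym \<Longrightarrow> f - g \<in> Sym"
  using Sym_add[of f "- g"] Sym_uminus[of g] by simp

lemma Sym_mult:
  assumes "f \<in> Sym" "g \<in> Sym"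
  shows "f * g \<in> Sym"
proof -
  obtain d where d: "\<And>M. d < size M \<Longrightarrow> mcoeff f M = 0"
    using Sym_degree_bound[OF assms(1)] by blast
  obtain e where e: "\<And>M. e < size M \<Longrightarrow> mcoeff g M = 0"
    using Sym_degree_bound[OF assms(2)] by blast
  show ?thesis
  proof (rule SymI[where d = "d + e"])
    fix \<sigma> :: "nat \<Rightarrow> nat" and M assume \<sigma>: "bij \<sigma>"
    define \<tau> where "\<tau> = inv_into UNIV \<sigma>"
    have \<tau>: "bij \<tau>" and inj: "inj \<sigma>" and ts [simp]: "\<And>x. \<tau> (\<sigma> x) = x" and st [simp]: "\<And>x. \<sigma> (\<tau> x) = x"
      using \<sigma> by (auto simp: \<tau>_def bij_imp_bij_inv bij_is_inj bij_is_surj surj_f_inv_f)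
    have "mcoeff (f * g) (image_mset \<sigma> M)
        = (\<Sum>A | A \<subseteq># image_mset \<sigma> M. mcoeff f A * mcoeff g (image_mset \<sigma> M - A))"
      by (simp add: times_mseries.rep_eq)
    also have "\<dots> = (\<Sum>A | A \<subseteq># M. mcoeff f A * mcoeff g (M - A))"
    proof (rule sum.reindex_bij_witness[where i = "image_mset \<sigma>" and j = "image_mset \<tau>"])
      fix A assume "A \<in> {A. A \<subseteq># image_mset \<sigma> M}"
      then have A: "A \<subseteq># image_mset \<sigma> M" by simp
      show "image_mset \<sigma> (image_mset \<tau> A) = A" by (simp add: multiset.map_comp comp_def)
      show "image_mset \<tau> A \<in> {A. A \<subseteq># M}"
        using image_mset_subseteq_mono[OF A, of \<tau>] by (simp add: multiset.map_comp comp_def)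
      have "M - image_mset \<tau> A = image_mset \<tau> (image_mset \<sigma> M - A)"
        using A by (subst image_mset_Diff) (simp_all add: multiset.map_comp comp_def)
      then show "mcoeff f (image_mset \<tau> A) * mcoeff g (M - image_mset \<tau> A)
          = mcoeff f A * mcoeff g (image_mset \<sigma> M - A)"
        using assms \<tau> by (simp add: Sym_image_mset)
    next
      fix A assume "A \<in> {A. A \<subseteq># M}"
      then show "image_mset \<tau> (image_mset \<sigma> A) = A" "image_mset \<sigma> A \<in> {A. A \<subseteq># image_mset \<sigma> M}"
        by (auto simp: multiset.map_comp comp_def image_mset_subseteq_mono)
    qed
    finally show "mcoeff (f * g) (image_mset \<sigma> M) = mcoeff (f * g) M"
      by (simp add: times_mseries.rep_eq)
  next
    fix M :: "nat multiset" assume M: "d + e < size M"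
    have "mcoeff f A * mcoeff g (M - A) = 0" if "A \<subseteq># M" for A
    proof -
      have "size M = size A + size (M - A)" using that by (metis size_union subset_mset.add_diff_inverse)
      then have "d < size A \<or> e < size (M - A)" using M by linarith
      then show ?thesis using d e by auto
    qed
    then show "mcoeff (f * g) M = 0"
      unfolding times_mseries.rep_eq by (intro sum.neutral) blast
  qed
qed

lemma Sym_sum: "(\<And>a. a \<in> A \<Longrightarrow> f a \<in> Sym) \<Longrightarrow> sum f A \<in> Sym"
  by (induction A rule: infinite_finite_induct) (auto simp: Sym_add)

lemma Sym_prod: "(\<And>a. a \<in> A \<Longrightarrow> f a \<in> Sym) \<Longrightarrow> prod f A \<in> Sym"
  by (induction A rule: infinite_finite_induct) (auto simp: Sym_mult)

lemma of_int_mult_eq_scale: "of_int k * f = of_int k *\<^sub>S f"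
  by (rule mseries_eqI) simp

lemma Sym_of_int_mult: "f \<in> Sym \<Longrightarrow> of_int k * f \<in> Sym"
  by (simp add: of_int_mult_eq_scale Sym_scale)

lemma Sym_dt:
  assumes "\<And>i j. i < n \<Longrightarrow> j < n \<Longrightarrow> A i j \<in> Sym"
  shows "dt n A \<in> Sym"
proof -
  have "p i < n" if "p permutes {..<n}" "i < n" for p :: "nat \<Rightarrow> nat" and i
    using permutes_in_image[OF that(1), of i] that(2) by simp
  with assms show ?thesis
    unfolding dt_eq_sum by (intro Sym_sum Sym_of_int_mult Sym_prod) auto
qed

lemma Sym_hsym [simp]: "hsym m \<in> Sym"
  by (rule SymI[where d = "nat m"]) (auto simp: hsym_def)

lemma hsym_neg: "m < 0 \<Longrightarrow> hsym m = 0"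
  by (rule mseries_eqI) (simp add: hsym_def)

lemma hsym_zero: "hsym 0 = 1"
  by (rule mseries_eqI) (simp add: hsym_def)

lemma count_image_mset_inj: "inj f \<Longrightarrow> count (image_mset f M) (f x) = count M x"
  by (induction M) (auto dest: injD)

lemma cf_permute:
  assumes f: "f \<in> Sym" and p: "p permutes {..<n}"
  shows "cf n f (\<lambda>i. \<alpha> (p i)) = cf n f \<alpha>"
proof -
  have bnd: "p i < n \<longleftrightarrow> i < n" for i using permutes_in_image[OF p, of i] by simp
  have all: "(\<forall>i<n. 0 \<le> \<alpha> (p i)) \<longleftrightarrow> (\<forall>i<n. 0 \<le> \<alpha> i)"
    using ball_simps(9)[of p "{..<n}" "\<lambda>i. 0 \<le> \<alpha> i"] permutes_image[OF p] by (simp add: Ball_def)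
  have "expo n (\<lambda>i. nat (\<alpha> i)) = image_mset p (expo n (\<lambda>i. nat (\<alpha> (p i))))"
  proof (rule multiset_eqI)
    fix x
    obtain y where x: "x = p y" using permutes_surj[OF p] by blast
    show "count (expo n (\<lambda>i. nat (\<alpha> i))) x = count (image_mset p (expo n (\<lambda>i. nat (\<alpha> (p i))))) x"
      unfolding x using permutes_inj[OF p] by (simp add: count_image_mset_inj count_expo bnd)
  qed
  then have "mcoeff f (expo n (\<lambda>i. nat (\<alpha> i))) = mcoeff f (expo n (\<lambda>i. nat (\<alpha> (p i))))"
    using f permutes_bij[OF p] by (simp add: Sym_image_mset)
  then show ?thesis unfolding cf_def all by (simp only:)
qed


section \<open>Complete symmetric functions and bialternants\<close>

definition hvars :: "nat set \<Rightarrow> int \<Rightarrow> scalar mseries" where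
  "hvars S m = MSeries (\<lambda>M. if set_mset M \<subseteq> S \<and> int (size M) = m then 1 else 0)"

lemma restrict_vars_hsym: "restrict_vars n (hsym m) = hvars {..<n} m"
  by (rule mseries_eqI) (auto simp: hvars_def hsym_def restrict_vars.rep_eq)

lemma hvars_remove:
  assumes "l \<in> S"
  shows "hvars (S - {l}) m = hvars S m - xvar (Suc l) * hvars S (m - 1)"
proof (rule mseries_eqI)
  fix M
  have "mcoeff (hvars S (m - 1) * mono_series {#l#}) M
      = (if l \<in># M \<and> set_mset M \<subseteq> S \<and> int (size M) = m then 1 else 0)"
  proof (cases "l \<in># M")
    case True
    then have "int (size (M - {#l#})) = int (size M) - 1"
      by (metis add_diff_cancel_left' insert_DiffM of_nat_Suc size_add_mset)
    moreover have "set_mset (M - {#l#}) \<subseteq> S \<longleftrightarrow> set_mset M \<subseteq> S"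
      using True assms by (metis insert_DiffM insert_subset set_mset_add_mset_insert)
    ultimately show ?thesis
      using True by (simp add: mcoeff_mult_mon hvars_def)
  qed (simp add: mcoeff_mult_mon)
  then show "mcoeff (hvars (S - {l}) m) M = mcoeff (hvars S m - xvar (Suc l) * hvars S (m - 1)) M"
    by (auto simp: xvar_eq_mon mult.commute[of "mono_series _"] hvars_def)
qed

lemma hvars_diff:
  assumes "finite T" "T \<subseteq> S"
  shows "\<exists>c. \<forall>m. hvars (S - T) m = (\<Sum>k\<le>card T. c k * hvars S (m - int k))"
  using assms
proof (induction T rule: finite_induct)
  case empty
  then show ?case by (intro exI[of _ "\<lambda>_. 1"]) simp
next
  case (insert l T)
  then obtain c where c: "\<And>m. hvars (S - T) m = (\<Sum>k\<le>card T. c k * hvars S (m - int k))"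
    by auto
  define c' where "c' = (\<lambda>k. (if k \<le> card T then c k else 0)
    - (if k = 0 then 0 else xvar (Suc l) * c (k - 1)))"
  have "hvars (S - insert l T) m = (\<Sum>k\<le>Suc (card T). c' k * hvars S (m - int k))" for m
  proof -
    have "hvars (S - insert l T) m = hvars (S - T) m - xvar (Suc l) * hvars (S - T) (m - 1)"
      using hvars_remove[of l "S - T" m] insert by (simp add: Diff_insert[symmetric])
    also have "\<dots> = (\<Sum>k\<le>Suc (card T). (if k \<le> card T then c k else 0) * hvars S (m - int k))
        - (\<Sum>k\<le>Suc (card T). (if k = 0 then 0 else xvar (Suc l) * c (k - 1)) * hvars S (m - int k))"
      unfolding c
      by (subst (2) sum.atMost_Suc_shift)
        (simp add: sum_distrib_left mult.assoc algebra_simps)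
    finally show ?thesis
      by (simp add: c'_def left_diff_distrib sum_subtractf)
  qed
  then show ?case using insert by auto
qed

lemma hvars_singleton: "hvars {l} (int e) = xvar (Suc l) ^ e"
proof -
  have "set_mset M \<subseteq> {l} \<and> size M = e \<longleftrightarrow> M = replicate_mset e l" for M
    using set_mset_subset_singletonD[of M l] by (auto split: if_splits)
  then show ?thesis
    by (intro mseries_eqI) (simp add: hvars_def xvar_power_eq_mon mono_series_def)
qed

lemma xvar_power_hsym_expansion:
  assumes "l < n"
  shows "\<exists>c. \<forall>e. xvar (Suc l) ^ e
    = (\<Sum>i<n. c i * restrict_vars n (hsym (int e + int i + 1 - int n)))"
proof -
  have 1: "{..<n} - ({..<n} - {l}) = {l}" and 2: "card ({..<n} - {l}) = n - 1"
    using assms by auto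
  obtain c where c: "\<And>m. hvars {l} m = (\<Sum>k\<le>n - 1. c k * hvars {..<n} (m - int k))"
    using hvars_diff[of "{..<n} - {l}" "{..<n}"] unfolding 1 2 by auto
  have "xvar (Suc l) ^ e = (\<Sum>i<n. c (n - 1 - i) * restrict_vars n (hsym (int e + int i + 1 - int n)))" for e
    unfolding hvars_singleton[symmetric] c restrict_vars_hsym
  proof (rule sum.reindex_bij_witness[where i = "\<lambda>i. n - 1 - i" and j = "\<lambda>i. n - 1 - i"])
    fix k assume "k \<in> {..n - 1}"
    then have "n - 1 - (n - 1 - k) = k" "int e + int (n - 1 - k) + 1 - int n = int e - int k"
      using assms by auto
    then show "c (n - 1 - (n - 1 - k)) * hvars {..<n} (int e + int (n - 1 - k) + 1 - int n)
        = c k * hvars {..<n} (int e - int k)"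
      by (simp only:)
  qed (use assms in auto)
  then show ?thesis by (intro exI[of _ "\<lambda>i. c (n - 1 - i)"]) blast
qed

text \<open>The Jacobi--Trudi identity for arbitrary alternants: a power of \<open>x\<^sub>l\<close> expands in complete
  symmetric functions with coefficients that do not depend on the exponent, so the matrices of
  both sides differ by a common factor, which the exponents \<open>n - 1 - j\<close> identify as the
  Vandermonde determinant.\<close>

lemma jacobi_trudi:
  "restrict_vars n (dt n (\<lambda>i j. \<Sum>e\<in>K j. b j e *\<^sub>S hsym (int e + int i + 1 - int n))) * vandermonde n
    = dt n (\<lambda>i j. \<Sum>e\<in>K j. b j e *\<^sub>S xvar (Suc i) ^ e)"
proof -
  let ?h = "\<lambda>e i. restrict_vars n (hsym (int e + int i + 1 - int n))"
  have "\<forall>l\<in>{..<n}. \<exists>c. \<forall>e. xvar (Suc l) ^ e = (\<Sum>i<n. c i * ?h e i)"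
    using xvar_power_hsym_expansion[of _ n] by simp
  from bchoice[OF this] obtain C
    where "\<forall>l\<in>{..<n}. \<forall>e. xvar (Suc l) ^ e = (\<Sum>i<n. C l i * ?h e i)" ..
  then have C: "\<And>l e. l < n \<Longrightarrow> xvar (Suc l) ^ e = (\<Sum>i<n. C l i * ?h e i)"
    by (simp only: lessThan_iff Ball_def)
  have "dt n (\<lambda>i j. \<Sum>e\<in>K j. b j e *\<^sub>S xvar (Suc i) ^ e)
      = dt n (\<lambda>l j. \<Sum>i<n. C l i * (\<Sum>e\<in>K j. b j e *\<^sub>S ?h e i))"
  proof (rule dt_cong)
    fix l j assume "l < n"
    then have "(\<Sum>e\<in>K j. b j e *\<^sub>S xvar (Suc l) ^ e) = (\<Sum>e\<in>K j. \<Sum>i<n. C l i * b j e *\<^sub>S ?h e i)"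
      by (simp add: C scale_sum_right scale_mult_right)
    also have "\<dots> = (\<Sum>i<n. C l i * (\<Sum>e\<in>K j. b j e *\<^sub>S ?h e i))"
      by (subst sum.swap) (simp add: sum_distrib_left)
    finally show "(\<Sum>e\<in>K j. b j e *\<^sub>S xvar (Suc l) ^ e)
      = (\<Sum>i<n. C l i * (\<Sum>e\<in>K j. b j e *\<^sub>S ?h e i))" .
  qed
  also have "\<dots> = dt n C * dt n (\<lambda>i j. \<Sum>e\<in>K j. b j e *\<^sub>S ?h e i)"
    by (rule dt_mult)
  also have "dt n C = vandermonde n"
  proof -
    have "vandermonde n = dt n (\<lambda>l j. \<Sum>i<n. C l i * ?h (n - 1 - j) i)"
      unfolding vandermonde_eq_dt by (rule dt_cong) (rule C)
    also have "\<dots> = dt n C * dt n (\<lambda>i j. ?h (n - 1 - j) i)"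
      by (rule dt_mult)
    also have "dt n (\<lambda>i j. ?h (n - 1 - j) i) = (\<Prod>i<n. ?h (n - 1 - i) i)"
      by (rule dt_lower_triangular) (auto simp: hsym_neg of_nat_diff)
    also have "\<dots> = 1"
      by (rule prod.neutral) (auto simp: of_nat_diff hsym_zero)
    finally show ?thesis by simp
  qed
  finally show ?thesis
    by (simp add: restrict_vars_dt restrict_vars_sum restrict_vars_scale mult.commute)
qed


section \<open>Partitions\<close>

lemma part_eq_zero: "ell nu \<le> i \<Longrightarrow> part nu (Suc i) = 0"
  by (simp add: part_def)

lemma part_pos: "i < ell nu \<Longrightarrow> 0 < part nu (Suc i)"
  using parts[of nu] nth_mem[of i "parts nu"] unfolding part_def ell_def
  by (cases "parts nu ! i") auto

lemma part_antimono: "i \<le> j \<Longrightarrow> part nu (Suc j) \<le> part nu (Suc i)"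
  using parts[of nu] unfolding part_def ell_def
  by (cases "i = j") (auto simp: sorted_wrt_iff_nth_less)

lemma ell_le_iff: "ell nu \<le> n \<longleftrightarrow> (\<forall>i\<ge>n. part nu (Suc i) = 0)"
proof
  assume "\<forall>i\<ge>n. part nu (Suc i) = 0"
  then show "ell nu \<le> n" using part_pos[of n nu] by (cases "n < ell nu") auto
qed (simp add: part_eq_zero)

lemma partition_eqI:
  assumes "ell mu \<le> n" "ell nu \<le> n" "\<And>i. i < n \<Longrightarrow> part mu (Suc i) = part nu (Suc i)"
  shows "mu = nu"
proof -
  have eq: "part mu (Suc i) = part nu (Suc i)" for i
    using assms by (cases "i < n") (auto simp: part_eq_zero)
  then have "ell mu \<le> m \<longleftrightarrow> ell nu \<le> m" for m
    by (simp add: ell_le_iff)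
  then have ell: "ell mu = ell nu" by (metis le_antisym le_refl)
  have "parts mu = parts nu"
  proof (rule nth_equalityI)
    show "length (parts mu) = length (parts nu)" using ell by (simp add: ell_def)
    show "parts mu ! i = parts nu ! i" if "i < length (parts mu)" for i
      using eq[of i] ell that by (simp add: part_def ell_def)
  qed
  then show ?thesis by (simp add: parts_inject)
qed

lemma partition_exists:
  assumes "\<And>i j. i \<le> j \<Longrightarrow> j < n \<Longrightarrow> f j \<le> f i"
  obtains nu where "ell nu \<le> n" "\<And>i. i < n \<Longrightarrow> part nu (Suc i) = f i"
proof -
  have "\<exists>nu. ell nu \<le> n \<and> (\<forall>i<n. part nu (Suc i) = f i)"
    using assms
  proof (induction n)
    case 0
    show ?case by (intro exI[of _ "Partition []"]) (simp add: ell_def Partition_inverse)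
  next
    case (Suc n)
    then obtain nu where nu: "ell nu \<le> n" "\<And>i. i < n \<Longrightarrow> part nu (Suc i) = f i"
      by auto
    show ?case
    proof (cases "f n = 0")
      case True
      then show ?thesis using nu by (intro exI[of _ nu]) (auto simp: less_Suc_eq part_eq_zero)
    next
      case False
      have pos: "f i \<noteq> 0" if "i < n" for i using Suc.prems[of i n] False that by simp
      have ell: "ell nu = n"
      proof (rule ccontr)
        assume "ell nu \<noteq> n"
        then have "ell nu < n" using nu(1) by simp
        then show False using nu(2)[of "ell nu"] pos[of "ell nu"] by (simp add: part_eq_zero)
      qed
      let ?xs = "map f [0..<Suc n]"
      have xs: "parts (Partition ?xs) = ?xs"
        using Suc.prems pos False
        by (intro Partition_inverse) (force simp: sorted_wrt_iff_nth_less nth_append less_Suc_eq)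
      then show ?thesis
        by (intro exI[of _ "Partition ?xs"]) (auto simp: ell_def part_def simp del: upt_Suc)
    qed
  qed
  then show ?thesis using that by blast
qed

definition psize :: "partition \<Rightarrow> nat" where
  "psize nu = (\<Sum>i<ell nu. part nu (Suc i))"

lemma sum_part: "ell nu \<le> n \<Longrightarrow> (\<Sum>i<n. part nu (Suc i)) = psize nu"
  unfolding psize_def by (rule sum.mono_neutral_right) (auto simp: part_eq_zero)

lemma ell_le_psize: "ell nu \<le> psize nu"
proof -
  have "(\<Sum>i<ell nu. 1) \<le> (\<Sum>i<ell nu. part nu (Suc i))"
    using part_pos[of _ nu] by (intro sum_mono) force
  then show ?thesis by (simp add: psize_def)
qed

lemma part_le_psize: "part nu (Suc i) \<le> psize nu"
proof (cases "i < ell nu")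
  case True
  then show ?thesis unfolding psize_def by (intro member_le_sum) auto
qed (simp add: part_eq_zero)

lemma finite_psize_le: "finite {nu. psize nu \<le> d}"
proof (rule finite_imageD)
  let ?f = "\<lambda>nu. restrict (\<lambda>i. part nu (Suc i)) {..<d}"
  show "inj_on ?f {nu. psize nu \<le> d}"
  proof (rule inj_onI)
    fix mu nu assume *: "mu \<in> {nu. psize nu \<le> d}" "nu \<in> {nu. psize nu \<le> d}" "?f mu = ?f nu"
    show "mu = nu"
    proof (rule partition_eqI[of _ d])
      show "ell mu \<le> d" "ell nu \<le> d" using * ell_le_psize le_trans by blast+
      show "part mu (Suc i) = part nu (Suc i)" if "i < d" for i
        using fun_cong[OF *(3), of i] that by simp
    qed
  qed
  have "?f ` {nu. psize nu \<le> d} \<subseteq> ({..<d} \<rightarrow>\<^sub>E {..d})"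
    using part_le_psize le_trans by fastforce
  then show "finite (?f ` {nu. psize nu \<le> d})"
    by (rule finite_subset) (simp add: finite_PiE)
qed

definition shifted :: "nat \<Rightarrow> partition \<Rightarrow> nat \<Rightarrow> int" where
  "shifted n nu i = int (part nu (Suc i)) + int n - 1 - int i"

lemma shifted_less: "i < j \<Longrightarrow> shifted n nu j < shifted n nu i"
  using part_antimono[of i j nu] by (simp add: shifted_def)

lemma strict_increasing_permutes_id:
  assumes p: "p permutes {..<n::nat}" and inc: "\<And>i j. i < j \<Longrightarrow> j < n \<Longrightarrow> p i < p j"
  shows "p = id"
proof -
  have ge: "i \<le> p i" if "i < n" for i
    using that
  proof (induction i)
    case (Suc i)
    then show ?case using inc[of i "Suc i"] by simp
  qed simp
  have "p i = i" if "i < n" for i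
    using that
  proof (induction "n - i" arbitrary: i rule: less_induct)
    case less
    show ?case
    proof (rule ccontr)
      assume "p i \<noteq> i"
      with ge[of i] less.prems have "i < p i" by simp
      moreover have "p i < n" using permutes_in_image[OF p, of i] less.prems by simp
      ultimately have "p (p i) = p i" using less.hyps[of "p i"] by simp
      then show False using \<open>p i \<noteq> i\<close> permutes_inj[OF p] by (auto dest: injD)
    qed
  qed
  then show ?thesis using permutes_not_in[OF p] by (intro ext) (metis id_apply lessThan_iff)
qed

lemma strict_decreasing_rearrange_id:
  assumes p: "p permutes {..<n::nat}" and "\<And>i. i < n \<Longrightarrow> f i = g (p i)"
    and f: "\<And>i j. i < j \<Longrightarrow> j < n \<Longrightarrow> f j < (f i :: int)"
    and g: "\<And>i j. i < j \<Longrightarrow> j < n \<Longrightarrow> g j < (g i :: int)"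
  shows "p = id"
proof (rule strict_increasing_permutes_id[OF p])
  fix i j assume ij: "i < j" "j < n"
  then have lt: "p i < n" "p j < n" using permutes_in_image[OF p] by simp_all
  have "g (p j) < g (p i)" using assms(2)[of i] assms(2)[of j] f[OF ij] ij by simp
  then show "p i < p j" using g[of "p j" "p i"] lt by (metis less_asym' not_less_iff_gr_or_eq)
qed


section \<open>Schur expansions\<close>

lemma restrict_vars_power: "restrict_vars n (f ^ k) = restrict_vars n f ^ k"
  by (induction k) (simp_all add: restrict_vars_mult)

lemma restrict_vars_vandermonde: "restrict_vars n (vandermonde n) = vandermonde n"
  unfolding vandermonde_eq_dt restrict_vars_dt
  by (rule dt_cong) (simp add: restrict_vars_power restrict_vars_xvar)

lemma cf_mult_dt:
  assumes "finite K"
  shows "cf n (f * dt n (\<lambda>i j. \<Sum>e\<in>K. c j e *\<^sub>S xvar (Suc i) ^ e)) \<alpha>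
    = (\<Sum>p | p permutes {..<n}. signof p * (\<Sum>e\<in>{..<n} \<rightarrow>\<^sub>E K.
        (\<Prod>i<n. c (p i) (e i)) * cf n f (\<lambda>i. \<alpha> i - int (e i))))"
proof -
  have "cf n (f * (\<Prod>i<n. \<Sum>e\<in>K. c (p i) e *\<^sub>S xvar (Suc i) ^ e)) \<alpha>
      = (\<Sum>e\<in>{..<n} \<rightarrow>\<^sub>E K. (\<Prod>i<n. c (p i) (e i)) * cf n f (\<lambda>i. \<alpha> i - int (e i)))" for p
    by (simp add: prod_sum_PiE assms sum_distrib_left cf_sum cf_prod_scale_mult)
  then show ?thesis
    unfolding dt_eq_sum
    by (simp add: sum_distrib_left cf_sum mult.left_commute[of f] cf_of_int_mult)
qed

lemma cf_mult_alternant: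
  "cf n (f * dt n (\<lambda>i j. xvar (Suc i) ^ e j)) \<alpha>
    = (\<Sum>p | p permutes {..<n}. signof p * cf n f (\<lambda>i. \<alpha> i - int (e (p i))))"
  unfolding dt_eq_sum
  by (simp add: sum_distrib_left cf_sum mult.left_commute[of f] cf_of_int_mult cf_mult_mon)

lemma cf_mult_vandermonde:
  "cf n (f * vandermonde n) \<alpha>
    = (\<Sum>p | p permutes {..<n}. signof p * cf n f (\<lambda>i. \<alpha> i - int (n - 1 - p i)))"
  unfolding vandermonde_eq_dt by (rule cf_mult_alternant)

lemma cf_mult_vandermonde_permute:
  assumes F: "F \<in> Sym" and q: "q permutes {..<n}"
  shows "cf n (F * vandermonde n) (\<lambda>i. \<alpha> (q i)) = signof q * cf n (F * vandermonde n) \<alpha>"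
proof -
  have perm: "permutation p" if "p permutes {..<n}" for p :: "nat \<Rightarrow> nat"
    using that by (rule permutes_imp_permutation[rotated]) simp
  have "cf n (F * vandermonde n) (\<lambda>i. \<alpha> (q i))
      = (\<Sum>p | p permutes {..<n}. signof (p \<circ> q) * cf n F (\<lambda>i. \<alpha> (q i) - int (n - 1 - p (q i))))"
    unfolding cf_mult_vandermonde by (subst sum_permutations_compose_right[OF q]) simp
  also have "\<dots> = (\<Sum>p | p permutes {..<n}. signof q * (signof p * cf n F (\<lambda>i. \<alpha> i - int (n - 1 - p i))))"
  proof (rule sum.cong[OF refl])
    fix p assume "p \<in> {p. p permutes {..<n}}"
    then have "sign (p \<circ> q) = sign p * sign q" using perm q by (simp add: sign_compose)
    then show "signof (p \<circ> q) * cf n F (\<lambda>i. \<alpha> (q i) - int (n - 1 - p (q i)))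
        = signof q * (signof p * cf n F (\<lambda>i. \<alpha> i - int (n - 1 - p i)))"
      using cf_permute[OF F q, of "\<lambda>i. \<alpha> i - int (n - 1 - p i)"] by simp
  qed
  finally show ?thesis
    by (simp add: cf_mult_vandermonde sum_distrib_left)
qed

lemma scalar_two_neq_zero: "(2 :: scalar) \<noteq> 0"
proof -
  have "(2 :: scalar) = Fract (of_nat 2) 1" using of_nat_fract[of 2] by simp
  also have "\<dots> \<noteq> 0" by (simp add: Zero_fract_def eq_fract)
  finally show ?thesis .
qed

lemma Sym_restrict_vars_eq_zeroI:
  assumes F: "F \<in> Sym"
    and zero: "\<And>nu. ell nu \<le> n \<Longrightarrow> cf n (F * vandermonde n) (shifted n nu) = 0"
  shows "restrict_vars n F = 0"
proof -
  let ?G = "F * vandermonde n"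
  have "cf n ?G \<alpha> = 0" for \<alpha>
  proof (cases "inj_on \<alpha> {..<n}")
    case False
    then obtain i j where ij: "i < n" "j < n" "i \<noteq> j" "\<alpha> i = \<alpha> j" by (auto simp: inj_on_def)
    let ?q = "Transposition.transpose i j"
    have "?q permutes {..<n}" using ij by (intro permutes_swap_id) auto
    then have "cf n ?G (\<lambda>k. \<alpha> (?q k)) = signof ?q * cf n ?G \<alpha>"
      by (rule cf_mult_vandermonde_permute[OF F])
    moreover have "(\<lambda>k. \<alpha> (?q k)) = \<alpha>" using ij by (auto simp: Transposition.transpose_def)
    ultimately have neg: "- cf n ?G \<alpha> = cf n ?G \<alpha>" using ij by (simp add: sign_swap_id)
    have "2 * cf n ?G \<alpha> = cf n ?G \<alpha> - - cf n ?G \<alpha>" by simp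
    also have "\<dots> = 0" unfolding neg by simp
    finally show ?thesis using scalar_two_neq_zero by simp
  next
    case inj: True
    show ?thesis
    proof (cases "\<forall>i<n. 0 \<le> \<alpha> i")
      case False
      then show ?thesis by (auto simp: cf_def)
    next
      case nonneg: True
      define ys where "ys = map \<alpha> [0..<n]"
      have "mset (rev (sort ys)) = mset ys" by simp
      then obtain q where q: "q permutes {..<length ys}" "permute_list q ys = rev (sort ys)"
        by (rule mset_eq_permutation)
      have len: "length ys = n" by (simp add: ys_def)
      have qn: "q permutes {..<n}" using q(1) len by simp
      have nth: "rev (sort ys) ! i = \<alpha> (q i)" if "i < n" for i
      proof -
        have "q i < n" using permutes_in_image[OF qn, of i] that by simp
        then show ?thesis
          using permute_list_nth[OF q(1), of i] that unfolding q(2) len by (simp add: ys_def)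
      qed
      have "sorted (sort ys)" "distinct (sort ys)"
        using inj by (auto simp: ys_def distinct_map atLeast0LessThan)
      then have "sorted_wrt (<) (sort ys)" by (simp add: strict_sorted_iff)
      then have "sorted_wrt (>) (rev (sort ys))" by (simp add: sorted_wrt_rev)
      then have dec: "\<alpha> (q j) < \<alpha> (q i)" if "i < j" "j < n" for i j
        using that nth sorted_wrt_nth_less[of "(>)" "rev (sort ys)" i j] len by simp
      have step: "\<alpha> (q j) + int j \<le> \<alpha> (q i) + int i" if "i \<le> j" "j < n" for i j
        using that
      proof (induction j)
        case (Suc j)
        then show ?case using dec[of j "Suc j"] by (cases "i = Suc j") auto
      qed simp
      have ge: "int n - 1 - int i \<le> \<alpha> (q i)" if "i < n" for i
      proof -
        have "q (n - 1) < n" using permutes_in_image[OF qn, of "n - 1"] that by simp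
        then have "0 \<le> \<alpha> (q (n - 1))" using nonneg by blast
        moreover have "i \<le> n - 1" "n - 1 < n" using that by simp_all
        ultimately show ?thesis using step[of i "n - 1"] by (simp add: of_nat_diff)
      qed
      obtain nu where nu: "ell nu \<le> n" "\<And>i. i < n \<Longrightarrow> part nu (Suc i) = nat (\<alpha> (q i) - (int n - 1 - int i))"
      proof (rule partition_exists[of n "\<lambda>i. nat (\<alpha> (q i) - (int n - 1 - int i))"])
        fix i j assume "i \<le> j" "j < n"
        then show "nat (\<alpha> (q j) - (int n - 1 - int j)) \<le> nat (\<alpha> (q i) - (int n - 1 - int i))"
          using step[of i j] by linarith
      qed blast
      have "cf n ?G (\<lambda>i. \<alpha> (q i)) = cf n ?G (shifted n nu)"
        by (rule cf_cong) (use nu(2) ge in \<open>simp add: shifted_def\<close>)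
      then have "signof q * cf n ?G \<alpha> = 0"
        using cf_mult_vandermonde_permute[OF F qn, of \<alpha>] zero[OF nu(1)] by simp
      then show ?thesis by (simp add: sign_def split: if_splits)
    qed
  qed
  then have "restrict_vars n ?G = restrict_vars n 0"
    by (intro restrict_vars_eqI) simp
  then have "restrict_vars n F * vandermonde n = 0"
    by (simp add: restrict_vars_mult restrict_vars_vandermonde)
  then show ?thesis by (rule vandermonde_cancel_zero)
qed

lemma eq_if_restrict_vars_eq:
  assumes "\<And>n. m \<le> n \<Longrightarrow> restrict_vars n f = restrict_vars n g"
  shows "f = g"
proof (rule mseries_eqI)
  fix M :: "nat multiset"
  obtain k where k: "set_mset M \<subseteq> {..<k}"
    using finite_nat_bounded[OF finite_set_mset] by blast
  then have "set_mset M \<subseteq> {..<max k m}" by auto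
  then show "mcoeff f M = mcoeff g M"
    using arg_cong[OF assms[of "max k m"], of "\<lambda>f. mcoeff f M"] by (simp add: restrict_vars.rep_eq)
qed

lemma dt_stable:
  assumes "m \<le> n" and "\<And>k. m \<le> k \<Longrightarrow> A k k = 1"
    and "\<And>i k. m \<le> k \<Longrightarrow> i < k \<Longrightarrow> A i k = 0"
  shows "dt n A = dt m A"
  using assms(1)
proof (induction n rule: dec_induct)
  case (step n)
  then show ?case using assms(2,3)[of n] by (subst dt_last_column) auto
qed simp

lemma schur_characterization:
  "schur lam \<in> Sym \<and> (\<forall>n\<ge>ell lam. restrict_vars n (schur lam) * vandermonde n
     = det1 n (\<lambda>i j. xvar i ^ (part lam j + n - j)))
   \<and> (\<forall>n\<ge>ell lam. schur lam = dt n (\<lambda>i j. hsym (int (part lam (Suc j)) + int i - int j)))"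
proof -
  define A where "A = (\<lambda>i j. hsym (int (part lam (Suc j)) + int i - int j))"
  have stable: "dt n A = dt (ell lam) A" if "ell lam \<le> n" for n
    by (rule dt_stable[OF that]) (auto simp: A_def part_eq_zero hsym_zero hsym_neg)
  have P: "dt (ell lam) A \<in> Sym \<and> (\<forall>n\<ge>ell lam. restrict_vars n (dt (ell lam) A) * vandermonde n
     = det1 n (\<lambda>i j. xvar i ^ (part lam j + n - j)))"
  proof (intro conjI allI impI)
    show "dt (ell lam) A \<in> Sym" by (intro Sym_dt) (simp add: A_def)
    fix n assume "ell lam \<le> n"
    then have "restrict_vars n (dt (ell lam) A) * vandermonde n = restrict_vars n (dt n A) * vandermonde n"
      by (subst stable) (assumption, rule refl)
    also have "dt n A = dt n (\<lambda>i j. \<Sum>e\<in>{part lam (Suc j) + n - Suc j}.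
        1 *\<^sub>S hsym (int e + int i + 1 - int n))"
      by (rule dt_cong) (simp add: A_def of_nat_diff algebra_simps)
    also have "restrict_vars n \<dots> * vandermonde n
        = dt n (\<lambda>i j. \<Sum>e\<in>{part lam (Suc j) + n - Suc j}. 1 *\<^sub>S xvar (Suc i) ^ e)"
      by (rule jacobi_trudi)
    also have "\<dots> = det1 n (\<lambda>i j. xvar i ^ (part lam j + n - j))"
      by (simp add: det1_eq_dt)
    finally show "restrict_vars n (dt (ell lam) A) * vandermonde n
      = det1 n (\<lambda>i j. xvar i ^ (part lam j + n - j))" .
  qed
  have S: "schur lam = dt (ell lam) A"
    unfolding schur_def
  proof (rule the_equality, rule P)
    fix f assume f: "f \<in> Sym \<and> (\<forall>n\<ge>ell lam. restrict_vars n f * vandermonde n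
     = det1 n (\<lambda>i j. xvar i ^ (part lam j + n - j)))"
    show "f = dt (ell lam) A"
    proof (rule eq_if_restrict_vars_eq)
      fix n assume "ell lam \<le> n"
      then have "restrict_vars n f * vandermonde n = restrict_vars n (dt (ell lam) A) * vandermonde n"
        using f P by simp
      then show "restrict_vars n f = restrict_vars n (dt (ell lam) A)"
        by (rule vandermonde_cancel)
    qed
  qed
  have "\<forall>n\<ge>ell lam. dt (ell lam) A = dt n A"
    by (intro allI impI) (rule stable[symmetric])
  with P show ?thesis
    unfolding S[symmetric] unfolding A_def by blast
qed

lemma Sym_schur [simp]: "schur lam \<in> Sym"
  using schur_characterization by blast

lemma schur_jacobi_trudi:
  "ell lam \<le> n \<Longrightarrow> schur lam = dt n (\<lambda>i j. hsym (int (part lam (Suc j)) + int i - int j))"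
  using schur_characterization by blast

lemma schur_bialternant:
  "ell lam \<le> n \<Longrightarrow> restrict_vars n (schur lam) * vandermonde n
    = dt n (\<lambda>i j. xvar (Suc i) ^ (part lam (Suc j) + n - Suc j))"
  using schur_characterization[of lam] unfolding det1_eq_dt by blast

lemma restrict_vars_vandermonde_Suc:
  "restrict_vars n (vandermonde (Suc n)) = (\<Prod>i<n. xvar (Suc i)) * vandermonde n"
proof -
  have "restrict_vars n (vandermonde (Suc n))
      = dt (Suc n) (\<lambda>i j. (if i < n then xvar (Suc i) else 0) ^ (n - j))"
    unfolding vandermonde_eq_dt restrict_vars_dt
    by (rule dt_cong) (simp add: restrict_vars_power restrict_vars_xvar)
  also have "\<dots> = dt n (\<lambda>i j. (if i < n then xvar (Suc i) else 0) ^ (n - j))"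
    by (subst dt_last_row) (auto simp: power_0_left)
  also have "\<dots> = dt n (\<lambda>i j. xvar (Suc i) * xvar (Suc i) ^ (n - 1 - j))"
    by (rule dt_cong) (simp flip: power_Suc add: Suc_diff_Suc)
  also have "\<dots> = (\<Prod>i<n. xvar (Suc i)) * vandermonde n"
    unfolding dt_scale_rows vandermonde_eq_dt ..
  finally show ?thesis .
qed

lemma cf_Suc: "\<alpha> n = 0 \<Longrightarrow> cf (Suc n) f \<alpha> = cf n f \<alpha>"
  by (simp add: cf_def less_Suc_eq all_conj_distrib expo_def cong: conj_cong)

lemma cf_mult_prod_xvar:
  "cf n ((\<Prod>i<n. xvar (Suc i)) * f) \<alpha> = cf n f (\<lambda>i. \<alpha> i - 1)"
  using cf_mult_mon[of n f "\<lambda>_. 1" \<alpha>] by (simp add: mult.commute)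

lemma cf_shifted_Suc:
  assumes "ell nu \<le> n" and "restrict_vars n G = (\<Prod>i<n. xvar (Suc i)) * H"
  shows "cf (Suc n) G (shifted (Suc n) nu) = cf n H (shifted n nu)"
proof -
  have "cf (Suc n) G (shifted (Suc n) nu) = cf n (restrict_vars n G) (shifted (Suc n) nu)"
    using assms(1) by (simp add: cf_Suc shifted_def part_eq_zero)
  also have "\<dots> = cf n H (\<lambda>i. shifted (Suc n) nu i - 1)"
    unfolding assms(2) by (rule cf_mult_prod_xvar)
  also have "\<dots> = cf n H (shifted n nu)"
    by (rule cf_cong) (simp add: shifted_def)
  finally show ?thesis .
qed

text \<open>By the bialternant formula, the coefficient of \<open>schur nu\<close> in \<open>F\<close> is a coefficient of \<open>F\<close> times
  the Vandermonde determinant, in any number \<open>n \<ge> ell nu\<close> of variables.\<close>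

definition scf :: "scalar mseries \<Rightarrow> partition \<Rightarrow> scalar" where
  "scf F nu = cf (ell nu) (F * vandermonde (ell nu)) (shifted (ell nu) nu)"

lemma scf_eq:
  assumes "ell nu \<le> n"
  shows "scf F nu = cf n (F * vandermonde n) (shifted n nu)"
  using assms
proof (induction n rule: dec_induct)
  case (step n)
  have "restrict_vars n (F * vandermonde (Suc n))
      = (\<Prod>i<n. xvar (Suc i)) * (restrict_vars n F * vandermonde n)"
    by (simp add: restrict_vars_mult restrict_vars_vandermonde_Suc mult_ac)
  from cf_shifted_Suc[OF step(1) this] have "cf (Suc n) (F * vandermonde (Suc n)) (shifted (Suc n) nu)
      = cf n (restrict_vars n F * vandermonde n) (shifted n nu)" .
  also have "\<dots> = cf n (restrict_vars n (F * vandermonde n)) (shifted n nu)"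
    by (simp add: restrict_vars_mult restrict_vars_vandermonde)
  finally show ?case using step.IH by simp
qed (simp add: scf_def)

lemma scf_diff: "scf (F - G) nu = scf F nu - scf G nu"
  by (simp add: scf_def left_diff_distrib cf_diff)

lemma scf_scale: "scf (c *\<^sub>S F) nu = c * scf F nu"
  by (simp add: scf_def scale_mult_left cf_scale)

lemma scf_sum: "scf (sum F A) nu = (\<Sum>a\<in>A. scf (F a) nu)"
  by (simp add: scf_def sum_distrib_right cf_sum)

lemma cf_one: "cf n 1 \<alpha> = (if \<forall>i<n. \<alpha> i = 0 then 1 else 0)"
proof -
  have "expo n a = {#} \<longleftrightarrow> (\<forall>i<n. a i = 0)" for a
    by (auto simp: multiset_eq_iff count_expo)
  then show ?thesis by (auto simp: cf_def intro: order.antisym)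
qed

lemma scf_schur: "scf (schur kappa) nu = (if nu = kappa then 1 else 0)"
proof -
  define n where "n = max (ell kappa) (ell nu)"
  have n: "ell kappa \<le> n" "ell nu \<le> n" by (simp_all add: n_def)
  have "scf (schur kappa) nu = cf n (restrict_vars n (schur kappa * vandermonde n)) (shifted n nu)"
    using n by (simp add: scf_eq)
  also have "\<dots> = cf n (1 * dt n (\<lambda>i j. xvar (Suc i) ^ (part kappa (Suc j) + n - Suc j))) (shifted n nu)"
    using schur_bialternant[OF n(1)] by (simp add: restrict_vars_mult restrict_vars_vandermonde)
  also have "\<dots> = (\<Sum>p | p permutes {..<n}. signof p *
      cf n 1 (\<lambda>i. shifted n nu i - int (part kappa (Suc (p i)) + n - Suc (p i))))"
    by (rule cf_mult_alternant)
  also have "\<dots> = (\<Sum>p | p permutes {..<n}. if p = id \<and> nu = kappa then 1 else 0)"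
  proof (rule sum.cong[OF refl])
    fix p assume "p \<in> {p. p permutes {..<n}}"
    then have p: "p permutes {..<n}" by simp
    have sh: "int (part kappa (Suc (p i)) + n - Suc (p i)) = shifted n kappa (p i)" if "i < n" for i
      using permutes_in_image[OF p, of i] that by (simp add: shifted_def of_nat_diff)
    have "(\<forall>i<n. shifted n nu i - int (part kappa (Suc (p i)) + n - Suc (p i)) = 0)
        \<longleftrightarrow> (\<forall>i<n. shifted n nu i = shifted n kappa (p i))"
      using sh by auto
    also have "\<dots> \<longleftrightarrow> p = id \<and> nu = kappa"
    proof
      assume eq: "\<forall>i<n. shifted n nu i = shifted n kappa (p i)"
      then have id: "p = id"
        using strict_decreasing_rearrange_id[OF p, of "shifted n nu" "shifted n kappa"] shifted_less
        by blast
      with eq have "\<forall>i<n. shifted n nu i = shifted n kappa i" by simp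
      then have "nu = kappa" using n by (intro partition_eqI[of _ n]) (auto simp: shifted_def)
      with id show "p = id \<and> nu = kappa" by simp
    qed simp
    finally have *: "cf n 1 (\<lambda>i. shifted n nu i - int (part kappa (Suc (p i)) + n - Suc (p i)))
        = (if p = id \<and> nu = kappa then 1 else 0)"
      by (simp only: cf_one)
    show "signof p * cf n 1 (\<lambda>i. shifted n nu i - int (part kappa (Suc (p i)) + n - Suc (p i)))
        = (if p = id \<and> nu = kappa then 1 else 0)"
      unfolding * by simp
  qed
  also have "\<dots> = (\<Sum>p\<in>{id :: nat \<Rightarrow> nat}. if p = id \<and> nu = kappa then 1 else 0)"
    by (rule sum.mono_neutral_right) (auto simp: permutes_id finite_permutations)
  finally show ?thesis by simp
qed

lemma cf_degree_bound:
  assumes "\<And>M. d < size M \<Longrightarrow> mcoeff F M = 0" and "int d < (\<Sum>i<n. \<alpha> i)"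
  shows "cf n F \<alpha> = 0"
proof (cases "\<forall>i<n. 0 \<le> \<alpha> i")
  case True
  then have "int (size (expo n (\<lambda>i. nat (\<alpha> i)))) = (\<Sum>i<n. \<alpha> i)"
    by (simp add: size_expo)
  with assms show ?thesis by (simp add: cf_def)
qed (auto simp: cf_def)

lemma scf_degree_bound:
  assumes d: "\<And>M. d < size M \<Longrightarrow> mcoeff F M = 0" and "d < psize nu"
  shows "scf F nu = 0"
proof -
  define n where "n = ell nu"
  have "cf n F (\<lambda>i. shifted n nu i - int (n - 1 - p i)) = 0" if p: "p permutes {..<n}" for p
  proof (rule cf_degree_bound[OF d])
    have "(\<Sum>i<n. shifted n nu i - int (n - 1 - p i))
        = (\<Sum>i<n. int (part nu (Suc i)) + (int (n - 1 - i) - int (n - 1 - p i)))"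
      by (rule sum.cong) (auto simp: shifted_def of_nat_diff)
    also have "\<dots> = int (psize nu) + (\<Sum>i<n. int (n - 1 - i)) - (\<Sum>i<n. int (n - 1 - p i))"
      using sum_part[of nu n] by (simp add: sum.distrib sum_subtractf n_def flip: of_nat_sum)
    also have "(\<Sum>i<n. int (n - 1 - p i)) = (\<Sum>i<n. int (n - 1 - i))"
      using sum.permute[OF p, of "\<lambda>i. int (n - 1 - i)"] by (simp add: comp_def)
    finally show "int d < (\<Sum>i<n. shifted n nu i - int (n - 1 - p i))"
      using assms(2) by simp
  qed simp
  then show ?thesis
    unfolding scf_def n_def[symmetric] cf_mult_vandermonde by simp
qed

lemma finite_scf:
  assumes "F \<in> Sym"
  shows "finite {nu. scf F nu \<noteq> 0}"
proof -
  obtain d where "\<And>M. d < size M \<Longrightarrow> mcoeff F M = 0"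
    using Sym_degree_bound[OF assms] by blast
  then have "{nu. scf F nu \<noteq> 0} \<subseteq> {nu. psize nu \<le> d}"
    using scf_degree_bound[of d F] by (auto simp: not_less[symmetric])
  then show ?thesis by (rule finite_subset) (rule finite_psize_le)
qed

lemma schur_sum_scf:
  assumes "finite A"
  shows "scf (\<Sum>kappa\<in>A. c kappa *\<^sub>S schur kappa) nu = (if nu \<in> A then c nu else 0)"
  using assms by (simp add: scf_sum scf_scale scf_schur if_distrib[of "times _"] sum.delta' cong: if_cong)

lemma schur_expansion_restrict:
  assumes "F \<in> Sym" "finite A" "\<And>nu. ell nu \<le> n \<Longrightarrow> scf F nu \<noteq> 0 \<Longrightarrow> nu \<in> A"
  shows "restrict_vars n F = restrict_vars n (\<Sum>nu\<in>A. scf F nu *\<^sub>S schur nu)"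
proof -
  have "restrict_vars n (F - (\<Sum>nu\<in>A. scf F nu *\<^sub>S schur nu)) = 0"
  proof (rule Sym_restrict_vars_eq_zeroI)
    show "F - (\<Sum>nu\<in>A. scf F nu *\<^sub>S schur nu) \<in> Sym"
      using assms by (intro Sym_diff Sym_sum Sym_scale) auto
    fix nu assume nu: "ell nu \<le> n"
    then have "scf F nu - (if nu \<in> A then scf F nu else 0) = 0"
      using assms(3) by auto
    then show "cf n ((F - (\<Sum>nu\<in>A. scf F nu *\<^sub>S schur nu)) * vandermonde n) (shifted n nu) = 0"
      using assms(2) by (simp flip: scf_eq[OF nu] add: scf_diff schur_sum_scf)
  qed
  then show ?thesis by (simp add: restrict_vars_diff)
qed

lemma schur_expansion:
  assumes "F \<in> Sym"
  shows "F = (\<Sum>nu | scf F nu \<noteq> 0. scf F nu *\<^sub>S schur nu)"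
  by (rule eq_if_restrict_vars_eq[of 0], rule schur_expansion_restrict)
    (auto simp: assms finite_scf)

lemma schur_coeff_eq_scf:
  assumes "F \<in> Sym"
  shows "schur_coeff F = scf F"
  unfolding schur_coeff_def
proof (rule the_equality)
  show "finite {nu. scf F nu \<noteq> 0} \<and> F = (\<Sum>nu | scf F nu \<noteq> 0. scf F nu *\<^sub>S schur nu)"
    using schur_expansion[OF assms] finite_scf[OF assms] by simp
  fix c assume c: "finite {nu. c nu \<noteq> 0} \<and> F = (\<Sum>nu | c nu \<noteq> 0. c nu *\<^sub>S schur nu)"
  show "c = scf F"
  proof
    fix nu
    show "c nu = scf F nu"
      using c schur_sum_scf[of "{nu. c nu \<noteq> 0}" c nu] by (metis (mono_tags, lifting) mem_Collect_eq)
  qed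
qed

lemma Sym_eqI:
  assumes "F \<in> Sym" "G \<in> Sym" "\<And>nu. scf F nu = scf G nu"
  shows "F = G"
  using schur_expansion[OF assms(1)] schur_expansion[OF assms(2)] assms(3) by simp

lemma hall_eq: 
  assumes "f \<in> Sym" "g \<in> Sym" "finite A" "\<And>nu. scf g nu \<noteq> 0 \<Longrightarrow> nu \<in> A"
  shows "hall f g = (\<Sum>nu\<in>A. scf f nu * scf g nu)"
  unfolding hall_def hall_hat_def schur_coeff_eq_scf[OF assms(1)] schur_coeff_eq_scf[OF assms(2)]
  by (rule sum.mono_neutral_left) (use assms in auto)


section \<open>The Hall pairing with products of complete symmetric functions\<close>

definition decomp :: "nat \<Rightarrow> (nat \<Rightarrow> nat) \<Rightarrow> nat multiset \<Rightarrow> (nat \<Rightarrow> nat multiset) set" where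
  "decomp n a M = {A \<in> extensional {..<n}. (\<Sum>i<n. A i) = M \<and> (\<forall>i<n. size (A i) = a i)}"

lemma bij_betw_decomp_Suc:
  "bij_betw (\<lambda>(C, A). A(n := M - C)) (SIGMA C:{C. C \<subseteq># M \<and> size (M - C) = a n}. decomp n a C)
    (decomp (Suc n) a M)"
proof (rule bij_betw_byWitness[where f' = "\<lambda>A. (\<Sum>i<n. A i, restrict A {..<n})"])
  show "\<forall>x\<in>(SIGMA C:{C. C \<subseteq># M \<and> size (M - C) = a n}. decomp n a C).
      (\<lambda>A. (\<Sum>i<n. A i, restrict A {..<n})) ((\<lambda>(C, A). A(n := M - C)) x) = x"
    by (auto simp: decomp_def extensional_def restrict_def fun_eq_iff)
  show "\<forall>A\<in>decomp (Suc n) a M.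
      (\<lambda>(C, A). A(n := M - C)) ((\<lambda>A. (\<Sum>i<n. A i, restrict A {..<n})) A) = A"
    by (auto simp: decomp_def extensional_def restrict_def fun_eq_iff)
  show "(\<lambda>(C, A). A(n := M - C)) ` (SIGMA C:{C. C \<subseteq># M \<and> size (M - C) = a n}. decomp n a C)
      \<subseteq> decomp (Suc n) a M"
    by (auto simp: decomp_def extensional_def less_Suc_eq)
  show "(\<lambda>A. (\<Sum>i<n. A i, restrict A {..<n})) ` decomp (Suc n) a M
      \<subseteq> (SIGMA C:{C. C \<subseteq># M \<and> size (M - C) = a n}. decomp n a C)"
    by (auto simp: decomp_def)
qed

lemma finite_decomp: "finite (decomp n a M)"
proof (induction n arbitrary: M)
  case 0
  have "decomp 0 a M \<subseteq> {\<lambda>_. undefined}" by (auto simp: decomp_def extensional_def)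
  then show ?case by (rule finite_subset) simp
next
  case (Suc n)
  have "finite {C. C \<subseteq># M \<and> size (M - C) = a n}"
    by (rule finite_subset[OF _ finite_submultisets[of M]]) auto
  then show ?case
    using bij_betw_finite[OF bij_betw_decomp_Suc[of n M a]] Suc.IH by (simp add: finite_SigmaI)
qed

lemma mcoeff_prod_hsym:
  "mcoeff (\<Prod>i<n. hsym (int (a i))) M = of_nat (card (decomp n a M))"
proof (induction n arbitrary: M)
  case 0
  have "decomp 0 a M = (if M = {#} then {\<lambda>_. undefined} else {})"
    by (auto simp: decomp_def extensional_def)
  then show ?case by simp
next
  case (Suc n)
  have "mcoeff (\<Prod>i<Suc n. hsym (int (a i))) M
      = (\<Sum>C | C \<subseteq># M. of_nat (card (decomp n a C)) * (if size (M - C) = a n then 1 else 0))"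
    by (simp add: times_mseries.rep_eq Suc.IH) (simp add: hsym_def)
  also have "\<dots> = (\<Sum>C | C \<subseteq># M \<and> size (M - C) = a n. of_nat (card (decomp n a C)))"
    by (rule sum.mono_neutral_cong_right) auto
  also have "\<dots> = of_nat (card (SIGMA C:{C. C \<subseteq># M \<and> size (M - C) = a n}. decomp n a C))"
    by (subst card_SigmaI) (auto simp: finite_decomp intro: finite_subset[OF _ finite_submultisets[of M]])
  also have "\<dots> = of_nat (card (decomp (Suc n) a M))"
    using bij_betw_same_card[OF bij_betw_decomp_Suc[of n M a]] by simp
  finally show ?case .
qed

text \<open>Both sides count the matrices of natural numbers with row sums \<open>a\<close> and column sums \<open>b\<close>;
  a matrix is encoded by the multisets given by its rows.\<close>

lemma card_decomp_swap: "card (decomp n a (expo N b)) = card (decomp N b (expo n a))"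
proof -
  define tr where "tr = (\<lambda>n N A. restrict (\<lambda>j. expo n (\<lambda>i. count (A i :: nat multiset) j)) {..<N::nat})"
  have supp: "set_mset (A i) \<subseteq> {..<N}" if "A \<in> decomp n a (expo N b)" "i < n" for A n N a b i
  proof -
    have "A i \<subseteq># expo N b"
      using that sum.remove[of "{..<n}" i A] mset_subset_eq_add_left[of "A i" "sum A ({..<n} - {i})"]
      by (simp add: decomp_def)
    then show ?thesis using set_mset_expo set_mset_mono by blast
  qed
  have size_eq: "size M = (\<Sum>j<N. count M j)" if "set_mset M \<subseteq> {..<N}" for M and N :: nat
    using size_expo[of N "count M"] expo_count[OF that] by simp
  have into: "tr n N A \<in> decomp N b (expo n a)" if A: "A \<in> decomp n a (expo N b)" for A n N a b
  proof -
    have "(\<Sum>j<N. tr n N A j) = expo n a"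
    proof (rule multiset_eqI)
      fix i
      have "(\<Sum>j<N. count (A i) j) = a i" if "i < n"
        using A that size_eq[OF supp[OF A that]] by (simp add: decomp_def)
      then show "count (\<Sum>j<N. tr n N A j) i = count (expo n a) i"
        by (simp add: tr_def count_sum count_expo)
    qed
    moreover have "size (tr n N A j) = b j" if "j < N" for j
    proof -
      have "size (tr n N A j) = count (\<Sum>i<n. A i) j"
        using that by (simp add: tr_def size_expo count_sum)
      then show ?thesis using A that by (simp add: decomp_def count_expo)
    qed
    ultimately show ?thesis by (simp add: decomp_def tr_def)
  qed
  have inverse: "tr N n (tr n N A) = A" if A: "A \<in> decomp n a (expo N b)" for A n N a b
  proof
    fix i
    show "tr N n (tr n N A) i = A i"
    proof (cases "i < n")
      case True
      then have "tr N n (tr n N A) i = expo N (count (A i))"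
        unfolding tr_def by (auto simp: count_expo intro!: expo_cong)
      then show ?thesis using expo_count[OF supp[OF A True]] by simp
    next
      case False
      then show ?thesis using A by (simp add: tr_def decomp_def extensional_def)
    qed
  qed
  have "bij_betw (tr n N) (decomp n a (expo N b)) (decomp N b (expo n a))"
    by (rule bij_betw_byWitness[where f' = "tr N n"]) (use into inverse in auto)
  then show ?thesis by (rule bij_betw_same_card)
qed

lemma cf_prod_hsym_swap:
  "cf N (\<Prod>i<n. hsym (a i)) b = cf n (\<Prod>j<N. hsym (b j)) a"
proof (cases "(\<forall>i<n. 0 \<le> a i) \<and> (\<forall>j<N. 0 \<le> b j)")
  case True
  then have "(\<Prod>i<n. hsym (a i)) = (\<Prod>i<n. hsym (int (nat (a i))))"
    "(\<Prod>j<N. hsym (b j)) = (\<Prod>j<N. hsym (int (nat (b j))))"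
    by (auto intro!: prod.cong)
  then have "mcoeff (\<Prod>i<n. hsym (a i)) M = of_nat (card (decomp n (\<lambda>i. nat (a i)) M))"
    "mcoeff (\<Prod>j<N. hsym (b j)) M = of_nat (card (decomp N (\<lambda>j. nat (b j)) M))" for M
    by (simp_all only: mcoeff_prod_hsym)
  with True show ?thesis
    by (simp add: cf_def card_decomp_swap)
next
  case False
  have zero: "(\<Prod>i<m. hsym (c i)) = 0" if "\<not> (\<forall>i<m. 0 \<le> c i)" for m and c :: "nat \<Rightarrow> int"
    using that by (intro prod_zero) (auto simp: not_le intro!: bexI hsym_neg)
  have neg: "cf m f c = 0" if "\<not> (\<forall>i<m. 0 \<le> c i)" for m and c :: "nat \<Rightarrow> int" and f :: "scalar mseries"
    using that unfolding cf_def by (rule if_not_P)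
  show ?thesis
    using False zero neg by (metis cf_zero)
qed

lemma scf_prod_hsym: "scf (\<Prod>i<n. hsym (a i)) nu = cf n (schur nu) a"
proof -
  define N where "N = ell nu"
  have "scf (\<Prod>i<n. hsym (a i)) nu
      = (\<Sum>p | p permutes {..<N}. signof p * cf N (\<Prod>i<n. hsym (a i)) (\<lambda>j. shifted N nu j - int (N - 1 - p j)))"
    unfolding scf_def N_def[symmetric] by (rule cf_mult_vandermonde)
  also have "\<dots> = (\<Sum>p | p permutes {..<N}. signof p *
      cf n (\<Prod>j<N. hsym (int (part nu (Suc j)) + int (p j) - int j)) a)"
  proof (rule sum.cong[OF refl])
    fix p assume "p \<in> {p. p permutes {..<N}}"
    then have "p j < N" if "j < N" for j
      using permutes_in_image[of p "{..<N}" j] that by simp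
    then have "shifted N nu j - int (N - 1 - p j) = int (part nu (Suc j)) + int (p j) - int j" if "j < N" for j
      using that by (force simp: shifted_def of_nat_diff)
    then have "cf N (\<Prod>i<n. hsym (a i)) (\<lambda>j. shifted N nu j - int (N - 1 - p j))
      = cf N (\<Prod>i<n. hsym (a i)) (\<lambda>j. int (part nu (Suc j)) + int (p j) - int j)"
      by (rule cf_cong)
    then show "signof p * cf N (\<Prod>i<n. hsym (a i)) (\<lambda>j. shifted N nu j - int (N - 1 - p j))
      = signof p * cf n (\<Prod>j<N. hsym (int (part nu (Suc j)) + int (p j) - int j)) a"
      by (simp only: cf_prod_hsym_swap)
  qed
  also have "\<dots> = cf n (dt N (\<lambda>i j. hsym (int (part nu (Suc i)) + int j - int i))) a"
    unfolding dt_eq_sum by (simp add: cf_sum cf_of_int_mult)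
  also have "dt N (\<lambda>i j. hsym (int (part nu (Suc i)) + int j - int i)) = schur nu"
    using schur_jacobi_trudi[of nu N] dt_transpose[of N "\<lambda>i j. hsym (int (part nu (Suc i)) + int j - int i)"]
    by (simp add: N_def)
  finally show ?thesis .
qed

lemma hall_prod_hsym:
  assumes "F \<in> Sym"
  shows "hall (\<Prod>i<n. hsym (a i)) F = cf n F a"
proof -
  have "hall (\<Prod>i<n. hsym (a i)) F = (\<Sum>nu | scf F nu \<noteq> 0. cf n (schur nu) a * scf F nu)"
    by (subst hall_eq[OF _ assms finite_scf[OF assms]]) (auto simp: Sym_prod scf_prod_hsym)
  also have "\<dots> = cf n (\<Sum>nu | scf F nu \<noteq> 0. scf F nu *\<^sub>S schur nu) a"
    by (simp add: cf_sum cf_scale mult.commute)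
  finally show ?thesis using schur_expansion[OF assms] by simp
qed

lemma hall_sum:
  assumes "g \<in> Sym" "\<And>a. a \<in> A \<Longrightarrow> f a \<in> Sym"
  shows "hall (sum f A) g = (\<Sum>a\<in>A. hall (f a) g)"
proof -
  have "hall (sum f A) g = (\<Sum>nu | scf g nu \<noteq> 0. \<Sum>a\<in>A. scf (f a) nu * scf g nu)"
    using assms by (subst hall_eq[OF _ _ finite_scf]) (auto simp: Sym_sum scf_sum sum_distrib_right)
  also have "\<dots> = (\<Sum>a\<in>A. \<Sum>nu | scf g nu \<noteq> 0. scf (f a) nu * scf g nu)"
    by (rule sum.swap)
  also have "\<dots> = (\<Sum>a\<in>A. hall (f a) g)"
    using assms by (intro sum.cong refl hall_eq[symmetric] finite_scf) auto
  finally show ?thesis .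
qed

lemma hall_scale:
  assumes "f \<in> Sym" "g \<in> Sym"
  shows "hall (c *\<^sub>S f) g = c * hall f g"
  using assms by (simp add: hall_eq[OF _ _ finite_scf] Sym_scale scf_scale sum_distrib_left mult.assoc)

lemma hall_commute:
  assumes "f \<in> Sym" "g \<in> Sym"
  shows "hall f g = hall g f"
proof -
  let ?A = "{nu. scf f nu \<noteq> 0} \<union> {nu. scf g nu \<noteq> 0}"
  have "finite ?A" using assms by (simp add: finite_scf)
  then show ?thesis
    using hall_eq[OF assms, of ?A] hall_eq[OF assms(2,1), of ?A] by (simp add: mult.commute)
qed

text \<open>The coefficients of \<open>F\<close> times an alternant are sums of coefficients of \<open>F\<close>, that is, of
  pairings of \<open>F\<close> with products of complete symmetric functions.\<close>

lemma hall_dt_hsym: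
  assumes F: "F \<in> Sym" and "finite K" "finite L"
  shows "hall (dt n (\<lambda>i j. \<Sum>e\<in>K. \<Sum>e'\<in>L. (c i e * d j e') *\<^sub>S hsym (int e - int e'))) F
    = (\<Sum>e\<in>{..<n} \<rightarrow>\<^sub>E K. (\<Prod>i<n. c i (e i)) *
        cf n (F * dt n (\<lambda>i j. \<Sum>e'\<in>L. d j e' *\<^sub>S xvar (Suc i) ^ e')) (\<lambda>i. int (e i)))"
proof -
  have prod_eq: "(\<Prod>i<n. \<Sum>e\<in>K. \<Sum>e'\<in>L. (c i e * d (p i) e') *\<^sub>S hsym (int e - int e'))
      = (\<Sum>e\<in>{..<n} \<rightarrow>\<^sub>E K. \<Sum>e'\<in>{..<n} \<rightarrow>\<^sub>E L.
          ((\<Prod>i<n. c i (e i)) * (\<Prod>i<n. d (p i) (e' i))) *\<^sub>S (\<Prod>i<n. hsym (int (e i) - int (e' i))))" for p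
    using assms by (simp add: prod_sum_PiE prod_scale prod.distrib)
  have "hall (dt n (\<lambda>i j. \<Sum>e\<in>K. \<Sum>e'\<in>L. (c i e * d j e') *\<^sub>S hsym (int e - int e'))) F
      = (\<Sum>p | p permutes {..<n}. signof p * (\<Sum>e\<in>{..<n} \<rightarrow>\<^sub>E K. \<Sum>e'\<in>{..<n} \<rightarrow>\<^sub>E L.
          ((\<Prod>i<n. c i (e i)) * (\<Prod>i<n. d (p i) (e' i))) * cf n F (\<lambda>i. int (e i) - int (e' i))))"
    unfolding dt_eq_sum prod_eq
    by (simp add: hall_sum hall_scale F Sym_sum Sym_scale Sym_prod hall_prod_hsym of_int_mult_eq_scale
        cong: sum.cong)
  also have "\<dots> = (\<Sum>e\<in>{..<n} \<rightarrow>\<^sub>E K. (\<Prod>i<n. c i (e i)) * (\<Sum>p | p permutes {..<n}. signof p *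
      (\<Sum>e'\<in>{..<n} \<rightarrow>\<^sub>E L. (\<Prod>i<n. d (p i) (e' i)) * cf n F (\<lambda>i. int (e i) - int (e' i)))))"
    by (simp add: sum_distrib_left mult_ac) (rule sum.swap)
  also have "\<dots> = (\<Sum>e\<in>{..<n} \<rightarrow>\<^sub>E K. (\<Prod>i<n. c i (e i)) *
        cf n (F * dt n (\<lambda>i j. \<Sum>e'\<in>L. d j e' *\<^sub>S xvar (Suc i) ^ e')) (\<lambda>i. int (e i)))"
    using assms(3) by (simp add: cf_mult_dt)
  finally show ?thesis .
qed


section \<open>Stable Grothendieck polynomials\<close>

definition stair :: "nat \<Rightarrow> partition \<Rightarrow> nat \<Rightarrow> nat" where
  "stair n nu j = part nu (Suc j) + n - Suc j"

lemma stair_shifted: "j < n \<Longrightarrow> int (stair n nu j) = shifted n nu j"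
  by (simp add: stair_def shifted_def of_nat_diff)

lemma stair_less: "i < j \<Longrightarrow> j < n \<Longrightarrow> stair n nu j < stair n nu i"
  using shifted_less[of i j n nu] by (simp flip: stair_shifted)

lemma stair_le: "j < n \<Longrightarrow> stair n nu j + j < psize nu + n"
  using part_le_psize[of nu j] by (simp add: stair_def)

lemma stair_Suc: "j < n \<Longrightarrow> stair (Suc n) nu j = Suc (stair n nu j)"
  by (simp add: stair_def)

lemma stair_last: "ell nu \<le> n \<Longrightarrow> stair (Suc n) nu n = 0"
  by (simp add: stair_def part_eq_zero)

lemma stair_eqD:
  assumes "ell mu \<le> n" "ell nu \<le> n" "\<And>i. i < n \<Longrightarrow> stair n mu i = stair n nu i"
  shows "mu = nu"
proof (rule partition_eqI[OF assms(1,2)])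
  fix i assume i: "i < n"
  then have "shifted n mu i = shifted n nu i" using assms(3)[OF i] by (simp flip: stair_shifted)
  then show "part mu (Suc i) = part nu (Suc i)" by (simp add: shifted_def)
qed

lemma sum_stair:
  assumes "ell nu \<le> n"
  shows "(\<Sum>i<n. stair n nu i) = psize nu + (\<Sum>i<n. n - Suc i)"
proof -
  have "(\<Sum>i<n. stair n nu i) = (\<Sum>i<n. part nu (Suc i) + (n - Suc i))"
    by (rule sum.cong) (auto simp: stair_def)
  also have "\<dots> = (\<Sum>i<n. part nu (Suc i)) + (\<Sum>i<n. n - Suc i)"
    by (rule sum.distrib)
  finally show ?thesis by (simp only: sum_part[OF assms])
qed

definition groth_col :: "nat \<Rightarrow> partition \<Rightarrow> nat \<Rightarrow> nat \<Rightarrow> scalar" where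
  "groth_col n lam j e = (if stair n lam j \<le> e
     then of_nat (j choose (e - stair n lam j)) * \<beta> ^ (e - stair n lam j) else 0)"

lemma groth_col_eq_zero: "stair n lam j + j < e \<Longrightarrow> groth_col n lam j e = 0"
  by (simp add: groth_col_def binomial_eq_0)

lemma sum_groth_col:
  fixes f :: "nat \<Rightarrow> 'a::comm_monoid_add"
  assumes "stair n lam j + j \<le> d" and "\<And>e. groth_col n lam j e = 0 \<Longrightarrow> f e = 0"
  shows "(\<Sum>e\<le>d. f e) = (\<Sum>m\<le>j. f (stair n lam j + m))"
proof -
  have "f e = 0" if "e \<notin> {stair n lam j..stair n lam j + j}" for e
    using that groth_col_eq_zero[of n lam j e] by (intro assms(2)) (auto simp: groth_col_def)
  then have "(\<Sum>e\<le>d. f e) = (\<Sum>e\<in>{stair n lam j..stair n lam j + j}. f e)"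
    using assms(1) by (intro sum.mono_neutral_right) auto
  also have "\<dots> = (\<Sum>m\<le>j. f (stair n lam j + m))"
    by (rule sum.reindex_bij_witness[where i = "\<lambda>m. stair n lam j + m" and j = "\<lambda>e. e - stair n lam j"]) auto
  finally show ?thesis .
qed

lemma groth_col_stair_add: "groth_col n lam j (stair n lam j + m) = of_nat (j choose m) * \<beta> ^ m"
  by (simp add: groth_col_def)

lemma scale_power: "(c *\<^sub>S f) ^ k = c ^ k *\<^sub>S f ^ k"
  by (induction k) (simp_all add: scale_mult_left scale_mult_right mult.commute)

lemma of_nat_mult_eq_scale: "of_nat k * f = of_nat k *\<^sub>S f"
  using of_int_mult_eq_scale[of "int k" f] by simp

lemma groth_col_expansion:
  assumes "j < n"
  shows "(\<Sum>e\<le>psize lam + n. groth_col n lam j e *\<^sub>S x ^ e) = x ^ stair n lam j * (1 + \<beta> *\<^sub>S x) ^ j"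
proof -
  have "(1 + \<beta> *\<^sub>S x) ^ j = (\<Sum>m\<le>j. (of_nat (j choose m) * \<beta> ^ m) *\<^sub>S x ^ m)"
    by (simp add: add.commute[of 1] binomial_ring scale_power of_nat_mult_eq_scale)
  then have "x ^ stair n lam j * (1 + \<beta> *\<^sub>S x) ^ j
      = (\<Sum>m\<le>j. groth_col n lam j (stair n lam j + m) *\<^sub>S x ^ (stair n lam j + m))"
    by (simp add: sum_distrib_left scale_mult_right power_add groth_col_stair_add)
  then show ?thesis
    using stair_le[OF assms, of lam] by (subst sum_groth_col[of n lam j]) auto
qed

definition groth_num :: "nat \<Rightarrow> partition \<Rightarrow> scalar mseries" where
  "groth_num n lam = dt n (\<lambda>i j. xvar (Suc i) ^ stair n lam j * (1 + \<beta> *\<^sub>S xvar (Suc i)) ^ j)"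

lemma groth_num_det1:
  "det1 n (\<lambda>i j. xvar i ^ (part lam j + n - j) * (1 + \<beta> *\<^sub>S xvar i) ^ (j - 1)) = groth_num n lam"
  by (simp add: det1_eq_dt groth_num_def stair_def)

lemma groth_num_expansion:
  "groth_num n lam = dt n (\<lambda>i j. \<Sum>e\<le>psize lam + n. groth_col n lam j e *\<^sub>S xvar (Suc i) ^ e)"
  unfolding groth_num_def by (rule dt_cong) (simp add: groth_col_expansion)

lemma restrict_vars_groth_num_Suc:
  assumes "ell lam \<le> n"
  shows "restrict_vars n (groth_num (Suc n) lam) = (\<Prod>i<n. xvar (Suc i)) * groth_num n lam"
proof -
  let ?y = "\<lambda>i. if i < n then xvar (Suc i) else 0 :: scalar mseries"
  have "restrict_vars n (groth_num (Suc n) lam)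
      = dt (Suc n) (\<lambda>i j. ?y i ^ stair (Suc n) lam j * (1 + \<beta> *\<^sub>S ?y i) ^ j)"
    unfolding groth_num_def restrict_vars_dt
    by (rule dt_cong)
      (simp add: restrict_vars_power restrict_vars_xvar restrict_vars_mult restrict_vars_add restrict_vars_scale)
  also have "\<dots> = dt n (\<lambda>i j. ?y i ^ stair (Suc n) lam j * (1 + \<beta> *\<^sub>S ?y i) ^ j)"
    using assms by (subst dt_last_row) (auto simp: stair_last stair_Suc)
  also have "\<dots> = dt n (\<lambda>i j. xvar (Suc i) * (xvar (Suc i) ^ stair n lam j * (1 + \<beta> *\<^sub>S xvar (Suc i)) ^ j))"
    by (rule dt_cong) (simp add: stair_Suc mult.assoc)
  also have "\<dots> = (\<Prod>i<n. xvar (Suc i)) * groth_num n lam"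
    unfolding dt_scale_rows groth_num_def ..
  finally show ?thesis .
qed

text \<open>The coefficient of \<open>schur nu\<close> in the stable Grothendieck polynomial of \<open>lam\<close>, read off from its
  numerator in the same way; any \<open>n \<ge> max (ell lam) (ell nu)\<close> gives the same value.\<close>

definition gcf :: "partition \<Rightarrow> partition \<Rightarrow> scalar" where
  "gcf lam nu = cf (max (ell lam) (ell nu)) (groth_num (max (ell lam) (ell nu)) lam)
     (shifted (max (ell lam) (ell nu)) nu)"

lemma gcf_eq:
  assumes "ell lam \<le> n" "ell nu \<le> n"
  shows "gcf lam nu = cf n (groth_num n lam) (shifted n nu)"
proof -
  have "max (ell lam) (ell nu) \<le> n" using assms by simp
  then show ?thesis
  proof (induction n rule: dec_induct)
    case (step n)
    have "cf (Suc n) (groth_num (Suc n) lam) (shifted (Suc n) nu) = cf n (groth_num n lam) (shifted n nu)"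
      using step(1) by (intro cf_shifted_Suc restrict_vars_groth_num_Suc) auto
    then show ?case using step.IH by simp
  qed (simp add: gcf_def)
qed

definition groth_det :: "nat \<Rightarrow> partition \<Rightarrow> scalar mseries" where
  "groth_det n lam = dt n (\<lambda>i j. \<Sum>e\<le>psize lam + n.
     groth_col n lam j e *\<^sub>S hsym (int e + int i + 1 - int n))"

lemma Sym_groth_det [simp]: "groth_det n lam \<in> Sym"
  unfolding groth_det_def by (intro Sym_dt Sym_sum Sym_scale Sym_hsym)

lemma restrict_vars_groth_det:
  "restrict_vars n (groth_det n lam) * vandermonde n = groth_num n lam"
  unfolding groth_det_def groth_num_expansion by (rule jacobi_trudi)

lemma cf_mult_vandermonde_restrict:
  "cf n (restrict_vars n F * vandermonde n) \<alpha> = cf n (F * vandermonde n) \<alpha>"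
  using cf_restrict_vars[of n "F * vandermonde n" \<alpha>]
  by (simp add: restrict_vars_mult restrict_vars_vandermonde)

lemma scf_groth_det:
  assumes "ell lam \<le> n" "ell nu \<le> n"
  shows "scf (groth_det n lam) nu = gcf lam nu"
proof -
  have "scf (groth_det n lam) nu = cf n (restrict_vars n (groth_det n lam) * vandermonde n) (shifted n nu)"
    by (simp only: scf_eq[OF assms(2)] cf_mult_vandermonde_restrict)
  then show ?thesis by (simp only: restrict_vars_groth_det gcf_eq[OF assms])
qed

lemma finite_gcf: "finite {nu. ell nu \<le> n \<and> gcf lam nu \<noteq> 0}"
proof (rule finite_subset)
  let ?n = "max n (ell lam)"
  show "{nu. ell nu \<le> n \<and> gcf lam nu \<noteq> 0} \<subseteq> {nu. scf (groth_det ?n lam) nu \<noteq> 0}"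
    using scf_groth_det[of lam ?n] by auto
qed (simp add: finite_scf)

lemma hat_eval_eq_restrict:
  "hat_eval n c = restrict_vars n (\<Sum>nu | ell nu \<le> n \<and> c nu \<noteq> 0. c nu *\<^sub>S schur nu)"
  by (simp add: hat_eval_def restrict_vars_sum restrict_vars_scale)

lemma hat_eval_gcf:
  assumes "ell lam \<le> n"
  shows "hat_eval n (gcf lam) = restrict_vars n (groth_det n lam)"
proof -
  let ?A = "{nu. ell nu \<le> n \<and> gcf lam nu \<noteq> 0}"
  have "restrict_vars n (groth_det n lam)
      = restrict_vars n (\<Sum>nu\<in>?A. scf (groth_det n lam) nu *\<^sub>S schur nu)"
    by (rule schur_expansion_restrict) (auto simp: finite_gcf scf_groth_det assms)
  also have "(\<Sum>nu\<in>?A. scf (groth_det n lam) nu *\<^sub>S schur nu) = (\<Sum>nu\<in>?A. gcf lam nu *\<^sub>S schur nu)"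
    by (rule sum.cong) (auto simp: scf_groth_det assms)
  finally show ?thesis by (simp add: hat_eval_eq_restrict)
qed

lemma groth_eq_gcf: "groth lam = gcf lam"
  unfolding groth_def groth_num_det1
proof (rule the_equality)
  show "gcf lam \<in> Sym_hat \<and> (\<forall>n\<ge>ell lam. hat_eval n (gcf lam) * vandermonde n = groth_num n lam)"
    by (simp add: Sym_hat_def finite_gcf hat_eval_gcf restrict_vars_groth_det)
  fix c assume c: "c \<in> Sym_hat \<and> (\<forall>n\<ge>ell lam. hat_eval n c * vandermonde n = groth_num n lam)"
  show "c = gcf lam"
  proof
    fix nu
    define n where "n = max (ell lam) (ell nu)"
    have n: "ell lam \<le> n" "ell nu \<le> n" by (simp_all add: n_def)
    let ?A = "{kappa. ell kappa \<le> n \<and> c kappa \<noteq> 0}"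
    have "finite ?A" using c by (auto simp: Sym_hat_def)
    then have "c nu = scf (\<Sum>kappa\<in>?A. c kappa *\<^sub>S schur kappa) nu"
      using n by (auto simp: schur_sum_scf)
    also have "\<dots> = cf n (hat_eval n c * vandermonde n) (shifted n nu)"
      by (simp only: scf_eq[OF n(2)] hat_eval_eq_restrict cf_mult_vandermonde_restrict)
    also have "\<dots> = gcf lam nu" using c n by (simp add: gcf_eq)
    finally show "c nu = gcf lam nu" .
  qed
qed

lemma hall_groth_det:
  assumes "F \<in> Sym"
  shows "hall (groth_det n lam) F = (\<Sum>e\<in>{..<n} \<rightarrow>\<^sub>E {..psize lam + n}.
    (\<Prod>i<n. groth_col n lam i (e i)) * cf n (F * vandermonde n) (\<lambda>i. int (e i)))"
proof -
  define d :: "nat \<Rightarrow> nat \<Rightarrow> scalar" where "d = (\<lambda>j e'. if e' = n - 1 - j then 1 else 0)"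
  have collapse: "(\<Sum>e'\<le>n. f e' (d j e')) = f (n - 1 - j) 1"
    if "\<And>e'. f e' 0 = 0" for j and f :: "nat \<Rightarrow> scalar \<Rightarrow> scalar mseries"
  proof -
    have "(\<Sum>e'\<le>n. f e' (d j e')) = (\<Sum>e'\<in>{n - 1 - j}. f e' (d j e'))"
      using that by (intro sum.mono_neutral_right) (auto simp: d_def)
    then show ?thesis by (simp add: d_def)
  qed
  have "groth_det n lam = dt n (\<lambda>i j. \<Sum>e\<le>psize lam + n.
      groth_col n lam i e *\<^sub>S hsym (int e + int j + 1 - int n))"
    unfolding groth_det_def by (rule dt_transpose[symmetric])
  also have "\<dots> = dt n (\<lambda>i j. \<Sum>e\<le>psize lam + n. \<Sum>e'\<le>n.
      (groth_col n lam i e * d j e') *\<^sub>S hsym (int e - int e'))"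
  proof (rule dt_cong)
    fix i j assume "j < n"
    then have sub: "int e - int (n - 1 - j) = int e + int j + 1 - int n" for e by (simp add: of_nat_diff)
    have "(\<Sum>e'\<le>n. (groth_col n lam i e * d j e') *\<^sub>S hsym (int e - int e'))
        = (groth_col n lam i e * 1) *\<^sub>S hsym (int e - int (n - 1 - j))" for e
      by (rule collapse) simp
    then show "(\<Sum>e\<le>psize lam + n. groth_col n lam i e *\<^sub>S hsym (int e + int j + 1 - int n))
      = (\<Sum>e\<le>psize lam + n. \<Sum>e'\<le>n. (groth_col n lam i e * d j e') *\<^sub>S hsym (int e - int e'))"
      by (simp only: sub mult_1_right)
  qed
  finally have det: "groth_det n lam = \<dots>" .
  have "vandermonde n = dt n (\<lambda>i j. \<Sum>e'\<le>n. d j e' *\<^sub>S xvar (Suc i) ^ e')"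
    unfolding vandermonde_eq_dt
    using collapse[of "\<lambda>e' x. x *\<^sub>S xvar (Suc i) ^ e'" for i] by (intro dt_cong) simp
  then show ?thesis
    unfolding det using assms by (simp add: hall_dt_hsym)
qed

lemma restrict_vars_schur_eq_zero:
  assumes "n < ell nu"
  shows "restrict_vars n (schur nu) = 0"
proof -
  have "restrict_vars n (schur nu) = restrict_vars n (\<Sum>kappa\<in>{}. scf (schur nu) kappa *\<^sub>S schur kappa)"
    by (rule schur_expansion_restrict) (use assms in \<open>auto simp: scf_schur split: if_splits\<close>)
  then show ?thesis by simp
qed

lemma scf_groth_det_eq_zero:
  assumes "n < ell nu"
  shows "scf (groth_det n lam) nu = 0"
proof -
  have "cf n (schur nu * vandermonde n) \<alpha> = 0" for \<alpha>
    using cf_mult_vandermonde_restrict[of n "schur nu" \<alpha>] restrict_vars_schur_eq_zero[OF assms] by simp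
  then have "hall (groth_det n lam) (schur nu) = 0"
    by (simp add: hall_groth_det)
  moreover have "hall (groth_det n lam) (schur nu) = scf (groth_det n lam) nu"
    by (subst hall_eq[of _ _ "{nu}"]) (auto simp: scf_schur split: if_splits)
  ultimately show ?thesis by simp
qed

lemma groth_trunc_eq:
  assumes "ell lam \<le> r"
  shows "groth_trunc r lam = groth_det r lam"
proof -
  let ?c = "scf (groth_det r lam)"
  have c_eq: "?c nu = (if ell nu \<le> r then gcf lam nu else 0)" for nu
    using assms by (simp add: scf_groth_det scf_groth_det_eq_zero)
  then have supp: "{nu. ?c nu \<noteq> 0} = {nu. ell nu \<le> r \<and> gcf lam nu \<noteq> 0}" by auto
  have p: "hat_eval r (gcf lam) = (\<Sum>nu | ?c nu \<noteq> 0. ?c nu *\<^sub>S restrict_vars r (schur nu))"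
    unfolding hat_eval_def supp by (rule sum.cong) (auto simp: c_eq)
  show ?thesis
    unfolding groth_trunc_def iota_def groth_eq_gcf
  proof (rule the_equality)
    show "\<exists>c. finite {\<nu>. c \<nu> \<noteq> 0} \<and> (\<forall>\<nu>. c \<nu> \<noteq> 0 \<longrightarrow> ell \<nu> \<le> r) \<and>
      hat_eval r (gcf lam) = (\<Sum>\<nu> | c \<nu> \<noteq> 0. c \<nu> *\<^sub>S restrict_vars r (schur \<nu>)) \<and>
      groth_det r lam = (\<Sum>\<nu> | c \<nu> \<noteq> 0. c \<nu> *\<^sub>S schur \<nu>)"
    proof (intro exI[of _ ?c] conjI allI impI)
      show "finite {nu. ?c nu \<noteq> 0}" by (rule finite_scf) simp
      show "ell nu \<le> r" if "?c nu \<noteq> 0" for nu using that c_eq by metis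
      show "groth_det r lam = (\<Sum>nu | ?c nu \<noteq> 0. ?c nu *\<^sub>S schur nu)"
        by (rule schur_expansion) simp
    qed (rule p)
    fix f
    assume "\<exists>c. finite {\<nu>. c \<nu> \<noteq> 0} \<and> (\<forall>\<nu>. c \<nu> \<noteq> 0 \<longrightarrow> ell \<nu> \<le> r) \<and>
      hat_eval r (gcf lam) = (\<Sum>\<nu> | c \<nu> \<noteq> 0. c \<nu> *\<^sub>S restrict_vars r (schur \<nu>)) \<and>
      f = (\<Sum>\<nu> | c \<nu> \<noteq> 0. c \<nu> *\<^sub>S schur \<nu>)"
    then obtain c where fin: "finite {\<nu>. c \<nu> \<noteq> 0}" and le: "\<And>\<nu>. c \<nu> \<noteq> 0 \<Longrightarrow> ell \<nu> \<le> r"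
      and pc: "hat_eval r (gcf lam) = (\<Sum>\<nu> | c \<nu> \<noteq> 0. c \<nu> *\<^sub>S restrict_vars r (schur \<nu>))"
      and f: "f = (\<Sum>\<nu> | c \<nu> \<noteq> 0. c \<nu> *\<^sub>S schur \<nu>)"
      by blast
    have "restrict_vars r f = restrict_vars r (groth_det r lam)"
      using pc hat_eval_gcf[OF assms] by (simp add: f restrict_vars_sum restrict_vars_scale)
    then have small: "scf f nu = ?c nu" if "ell nu \<le> r" for nu
      using that cf_mult_vandermonde_restrict[of r f] cf_mult_vandermonde_restrict[of r "groth_det r lam"]
      by (simp add: scf_eq)
    have f_coeff: "scf f nu = c nu" for nu
      unfolding f using fin by (simp add: schur_sum_scf)
    show "f = groth_det r lam"
    proof (rule Sym_eqI)
      show "f \<in> Sym" unfolding f by (intro Sym_sum Sym_scale Sym_schur)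
      show "scf f nu = ?c nu" for nu
        using small[of nu] f_coeff[of nu] le[of nu] c_eq[of nu] by (cases "ell nu \<le> r") auto
    qed simp
  qed
qed

lemma cf_alternant:
  fixes c :: "nat \<Rightarrow> nat \<Rightarrow> scalar"
  assumes "finite K"
  shows "cf n (dt n (\<lambda>i j. \<Sum>e\<in>K. c j e *\<^sub>S xvar (Suc i) ^ e)) (\<lambda>i. int (s i))
    = dt n (\<lambda>i j. if s i \<in> K then c j (s i) else 0)"
proof -
  have term_eq: "(\<Sum>e\<in>{..<n} \<rightarrow>\<^sub>E K. (\<Prod>i<n. c (p i) (e i)) * cf n 1 (\<lambda>i. int (s i) - int (e i)))
      = (\<Prod>i<n. if s i \<in> K then c (p i) (s i) else 0)" for p
  proof -
    have "cf n 1 (\<lambda>i. int (s i) - int (e i)) = (\<Prod>i<n. if s i = e i then 1 else 0 :: scalar)" for e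
    proof (cases "\<forall>i<n. s i = e i")
      case True
      then show ?thesis by (simp add: cf_one)
    next
      case False
      then have "(\<Prod>i<n. if s i = e i then 1 else 0 :: scalar) = 0" by (intro prod_zero) auto
      with False show ?thesis by (auto simp: cf_one)
    qed
    then have "(\<Sum>e\<in>{..<n} \<rightarrow>\<^sub>E K. (\<Prod>i<n. c (p i) (e i)) * cf n 1 (\<lambda>i. int (s i) - int (e i)))
        = (\<Sum>e\<in>{..<n} \<rightarrow>\<^sub>E K. \<Prod>i<n. c (p i) (e i) * (if s i = e i then 1 else 0))"
      by (simp add: prod.distrib)
    also have "\<dots> = (\<Prod>i<n. \<Sum>e\<in>K. c (p i) e * (if s i = e then 1 else 0))"
      using assms by (simp add: prod_sum_PiE)
    also have "\<dots> = (\<Prod>i<n. if s i \<in> K then c (p i) (s i) else 0)"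
      using assms by (intro prod.cong refl) (simp add: if_distrib[of "times _"] cong: if_cong)
    finally show ?thesis .
  qed
  have "cf n (dt n (\<lambda>i j. \<Sum>e\<in>K. c j e *\<^sub>S xvar (Suc i) ^ e)) (\<lambda>i. int (s i))
      = cf n (1 * dt n (\<lambda>i j. \<Sum>e\<in>K. c j e *\<^sub>S xvar (Suc i) ^ e)) (\<lambda>i. int (s i))"
    by simp
  also have "\<dots> = (\<Sum>p | p permutes {..<n}. signof p * (\<Prod>i<n. if s i \<in> K then c (p i) (s i) else 0))"
    unfolding cf_mult_dt[OF assms] term_eq ..
  finally show ?thesis by (simp only: dt_eq_sum)
qed

lemma gcf_eq_dt:
  assumes "ell lam \<le> n" "ell nu \<le> n"
  shows "gcf lam nu = dt n (\<lambda>i j. groth_col n lam j (stair n nu i))"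
proof -
  have "gcf lam nu = cf n (groth_num n lam) (\<lambda>i. int (stair n nu i))"
    unfolding gcf_eq[OF assms] by (rule cf_cong) (simp add: stair_shifted)
  also have "\<dots> = dt n (\<lambda>i j. if stair n nu i \<in> {..psize lam + n} then groth_col n lam j (stair n nu i) else 0)"
    unfolding groth_num_expansion by (rule cf_alternant) simp
  also have "\<dots> = dt n (\<lambda>i j. groth_col n lam j (stair n nu i))"
  proof (rule dt_cong)
    fix i j assume "j < n"
    then show "(if stair n nu i \<in> {..psize lam + n} then groth_col n lam j (stair n nu i) else 0)
        = groth_col n lam j (stair n nu i)"
      using stair_le[of j n lam] groth_col_eq_zero[of n lam j "stair n nu i"] by auto
  qed
  finally show ?thesis .
qed

lemma gcf_self: "gcf lam lam = 1"
proof -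
  have "gcf lam lam = dt (ell lam) (\<lambda>i j. groth_col (ell lam) lam j (stair (ell lam) lam i))"
    by (rule gcf_eq_dt) simp_all
  also have "\<dots> = (\<Prod>i<ell lam. groth_col (ell lam) lam i (stair (ell lam) lam i))"
    by (rule dt_upper_triangular) (auto simp: groth_col_def dest: stair_less[of _ _ "ell lam" lam])
  finally show ?thesis by (simp add: groth_col_def)
qed

lemma dt_eq_zeroI:
  assumes "\<And>p. p permutes {..<n} \<Longrightarrow> \<exists>i<n. A i (p i) = 0"
  shows "dt n A = 0"
  unfolding dt_eq_sum
proof (rule sum.neutral, rule ballI)
  fix p assume "p \<in> {p. p permutes {..<n}}"
  then have "(\<Prod>i<n. A i (p i)) = 0" using assms[of p] by (intro prod_zero) auto
  then show "signof p * (\<Prod>i<n. A i (p i)) = 0" by simp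
qed

lemma gcf_eq_zero:
  assumes "psize nu \<le> psize lam" "nu \<noteq> lam"
  shows "gcf lam nu = 0"
proof -
  define n where "n = max (ell lam) (ell nu)"
  have n: "ell lam \<le> n" "ell nu \<le> n" by (simp_all add: n_def)
  show ?thesis
    unfolding gcf_eq_dt[OF n]
  proof (rule dt_eq_zeroI, rule ccontr)
    fix p assume p: "p permutes {..<n}"
      and "\<not> (\<exists>i<n. groth_col n lam (p i) (stair n nu i) = 0)"
    then have le: "stair n lam (p i) \<le> stair n nu i" if "i < n" for i
      using that unfolding groth_col_def by (meson not_less)
    have "(\<Sum>i<n. stair n lam (p i)) = (\<Sum>i<n. stair n lam i)"
      using sum.permute[OF p, of "stair n lam"] by (simp add: comp_def)
    then have "(\<Sum>i<n. stair n nu i) \<le> (\<Sum>i<n. stair n lam (p i))"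
      using assms(1) n by (simp add: sum_stair)
    then have eq: "stair n nu i = stair n lam (p i)" if "i < n" for i
      using that le sum_strict_mono_ex1[of "{..<n}" "\<lambda>i. stair n lam (p i)" "stair n nu"]
      by (metis finite_lessThan le_antisym lessThan_iff not_le)
    have "p = id"
    proof (rule strict_decreasing_rearrange_id[OF p])
      show "int (stair n nu i) = int (stair n lam (p i))" if "i < n" for i
        using eq[OF that] by simp
      show "int (stair n nu j) < int (stair n nu i)" "int (stair n lam j) < int (stair n lam i)"
        if "i < j" "j < n" for i j
        using stair_less[OF that] by simp_all
    qed
    then have "nu = lam" using eq n by (intro stair_eqD[of _ n]) auto
    with assms(2) show False ..
  qed
qed


section \<open>Dual stable Grothendieck polynomials\<close>

definition dual_col :: "nat \<Rightarrow> partition \<Rightarrow> nat \<Rightarrow> nat \<Rightarrow> scalar" where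
  "dual_col n mu j e = (if e \<le> stair n mu j
     then of_int (zbinom (- int j) (int (stair n mu j - e))) * \<beta> ^ (stair n mu j - e) else 0)"

definition dual_det :: "nat \<Rightarrow> partition \<Rightarrow> scalar mseries" where
  "dual_det n mu = dt n (\<lambda>i j. \<Sum>e\<le>psize mu + n.
     dual_col n mu j e *\<^sub>S hsym (int e + int i + 1 - int n))"

lemma Sym_dual_det [simp]: "dual_det n mu \<in> Sym"
  unfolding dual_det_def by (intro Sym_dt Sym_sum Sym_scale Sym_hsym)

lemma zbinom_zero: "zbinom a 0 = 1"
  by (simp add: zbinom_def)

lemma dual_det_Suc:
  assumes "ell mu \<le> n"
  shows "dual_det (Suc n) mu = dual_det n mu"
proof -
  have last_col: "(\<Sum>e\<le>psize mu + Suc n. dual_col (Suc n) mu n e *\<^sub>S hsym (int e + int i + 1 - int (Suc n)))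
      = hsym (int i - int n)" for i
  proof -
    have "(\<Sum>e\<le>psize mu + Suc n. dual_col (Suc n) mu n e *\<^sub>S hsym (int e + int i + 1 - int (Suc n)))
        = (\<Sum>e\<in>{0}. dual_col (Suc n) mu n e *\<^sub>S hsym (int e + int i + 1 - int (Suc n)))"
      by (rule sum.mono_neutral_right) (auto simp: dual_col_def stair_last[OF assms])
    then show ?thesis by (simp add: dual_col_def stair_last[OF assms] zbinom_zero)
  qed
  have "dual_det (Suc n) mu = dt n (\<lambda>i j. \<Sum>e\<le>psize mu + Suc n.
      dual_col (Suc n) mu j e *\<^sub>S hsym (int e + int i + 1 - int (Suc n)))"
    unfolding dual_det_def
    by (subst dt_last_column) (simp_all only: last_col, simp_all add: hsym_neg hsym_zero)
  also have "\<dots> = dual_det n mu"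
    unfolding dual_det_def
  proof (rule dt_cong)
    fix i j assume ij: "i < n" "j < n"
    have col: "dual_col (Suc n) mu j (Suc e) = dual_col n mu j e" for e
      unfolding dual_col_def stair_Suc[OF ij(2)] by simp
    have "(\<Sum>e\<le>psize mu + Suc n. dual_col (Suc n) mu j e *\<^sub>S hsym (int e + int i + 1 - int (Suc n)))
        = dual_col (Suc n) mu j 0 *\<^sub>S hsym (int i - int n)
          + (\<Sum>e\<le>psize mu + n. dual_col (Suc n) mu j (Suc e) *\<^sub>S hsym (int e + int i + 1 - int n))"
      unfolding add_Suc_right by (subst sum.atMost_Suc_shift) (simp add: algebra_simps)
    also have "hsym (int i - int n) = 0" using ij by (simp add: hsym_neg)
    finally show "(\<Sum>e\<le>psize mu + Suc n. dual_col (Suc n) mu j e *\<^sub>S hsym (int e + int i + 1 - int (Suc n)))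
        = (\<Sum>e\<le>psize mu + n. dual_col n mu j e *\<^sub>S hsym (int e + int i + 1 - int n))"
      by (simp only: col scale_zero_right add_0_left)
  qed
  finally show ?thesis .
qed

lemma dual_det_eq: "ell mu \<le> n \<Longrightarrow> dual_det n mu = dual_det (ell mu) mu"
  by (induction n rule: dec_induct) (simp_all add: dual_det_Suc)

definition pairing_det :: "nat \<Rightarrow> partition \<Rightarrow> partition \<Rightarrow> scalar mseries" where
  "pairing_det r lam mu = dt r (\<lambda>i j. \<Sum>e\<le>psize lam + r. \<Sum>e'\<le>psize mu + r.
     (groth_col r lam i e * dual_col r mu j e') *\<^sub>S hsym (int e - int e'))"

lemma Sym_pairing_det [simp]: "pairing_det r lam mu \<in> Sym"
  unfolding pairing_det_def by (intro Sym_dt Sym_sum Sym_scale Sym_hsym)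

lemma hall_pairing_det:
  assumes "ell mu \<le> r" "h \<in> Sym"
  shows "hall (pairing_det r lam mu) h = hall (groth_det r lam) (dual_det (ell mu) mu * h)"
proof -
  let ?g = "dual_det (ell mu) mu"
  let ?psi = "dt r (\<lambda>i j. \<Sum>e'\<le>psize mu + r. dual_col r mu j e' *\<^sub>S xvar (Suc i) ^ e')"
  have "?psi = restrict_vars r ?g * vandermonde r"
    unfolding dual_det_eq[OF assms(1), symmetric] unfolding dual_det_def
    by (rule jacobi_trudi[symmetric])
  then have "cf r (h * ?psi) \<alpha> = cf r (?g * h * vandermonde r) \<alpha>" for \<alpha>
    using cf_restrict_vars[of r "h * ?psi" \<alpha>] cf_restrict_vars[of r "?g * h * vandermonde r" \<alpha>]
    by (simp add: restrict_vars_mult restrict_vars_restrict_vars mult_ac)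
  then show ?thesis
    unfolding pairing_det_def
    using assms(2) by (simp add: hall_dt_hsym hall_groth_det Sym_mult)
qed

lemma of_int_zbinom: "of_int (zbinom a (int k)) = (of_int a :: rat) gchoose k"
  using of_int_gbinomial[of a k, where 'a = rat] unfolding gbinomial_prod_rev[of a k]
  by (simp add: zbinom_def atLeast0LessThan)

lemma zbinom_binomial: "zbinom (int i) (int k) = int (i choose k)"
  using gbinomial_int_binomial[of "int i" k] unfolding gbinomial_prod_rev[of "int i" k]
  by (simp add: zbinom_def atLeast0LessThan)

lemma zbinom_vandermonde:
  "(\<Sum>k\<le>n. int (i choose k) * zbinom (- int j) (int (n - k))) = zbinom (int i - int j) (int n)"
proof -
  have "(of_int (\<Sum>k\<le>n. int (i choose k) * zbinom (- int j) (int (n - k))) :: rat)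
      = of_int (zbinom (int i - int j) (int n))"
    using gbinomial_Vandermonde[of "of_nat i :: rat" "- of_nat j" n]
    by (simp add: of_int_zbinom binomial_gbinomial atLeast0AtMost del: of_nat_diff)
  then show ?thesis by (simp only: of_int_eq_iff)
qed

lemma mcoeff_empty_mult: "mcoeff (f * g) {#} = mcoeff f {#} * mcoeff g {#}"
  by (simp add: times_mseries.rep_eq)

lemma mcoeff_empty_prod: "mcoeff (prod f A) {#} = (\<Prod>a\<in>A. mcoeff (f a) {#})"
  by (induction A rule: infinite_finite_induct) (simp_all add: mcoeff_empty_mult)

lemma mcoeff_empty_dt: "mcoeff (dt n A) {#} = dt n (\<lambda>i j. mcoeff (A i j) {#})"
  unfolding dt_eq_sum by (simp add: mcoeff_empty_prod)

lemma sum_groth_col_dual_col: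
  assumes "i < n" "j < n"
  shows "(\<Sum>e\<le>psize lam + n. groth_col n lam i e * dual_col n mu j e)
    = (if stair n lam i \<le> stair n mu j
       then of_int (zbinom (int i - int j) (int (stair n mu j - stair n lam i)))
         * \<beta> ^ (stair n mu j - stair n lam i) else 0)"
proof -
  define a b where "a = stair n lam i" and "b = stair n mu j"
  have zero: "groth_col n lam i e * dual_col n mu j e = 0" if "e \<notin> {a..b}" for e
    using that by (auto simp: groth_col_def dual_col_def a_def b_def)
  have zero': "groth_col n lam i e * dual_col n mu j e = 0" if "psize lam + n < e" for e
    using that stair_le[OF assms(1), of lam] by (simp add: groth_col_eq_zero)
  have "(\<Sum>e\<le>psize lam + n. groth_col n lam i e * dual_col n mu j e)
      = (\<Sum>e\<le>max (psize lam + n) b. groth_col n lam i e * dual_col n mu j e)"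
    using zero' by (intro sum.mono_neutral_left) auto
  also have "\<dots> = (\<Sum>e\<in>{a..b}. groth_col n lam i e * dual_col n mu j e)"
    using zero by (intro sum.mono_neutral_right) auto
  also have "\<dots> = (if a \<le> b then of_int (zbinom (int i - int j) (int (b - a))) * \<beta> ^ (b - a) else 0)"
  proof (cases "a \<le> b")
    case True
    have "(\<Sum>e\<in>{a..b}. groth_col n lam i e * dual_col n mu j e)
        = (\<Sum>k\<le>b - a. of_int (int (i choose k) * zbinom (- int j) (int (b - a - k))) * \<beta> ^ (b - a))"
    proof (rule sum.reindex_bij_witness[where i = "\<lambda>k. a + k" and j = "\<lambda>e. e - a"])
      fix e assume e: "e \<in> {a..b}"
      then have "\<beta> ^ (e - a) * \<beta> ^ (b - e) = \<beta> ^ (b - a)" and "b - a - (e - a) = b - e"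
        by (simp_all flip: power_add)
      then show "of_int (int (i choose (e - a)) * zbinom (- int j) (int (b - a - (e - a)))) * \<beta> ^ (b - a)
          = groth_col n lam i e * dual_col n mu j e"
        using e by (simp add: groth_col_def dual_col_def mult_ac flip: a_def b_def)
    qed (use True in auto)
    also have "\<dots> = of_int (\<Sum>k\<le>b - a. int (i choose k) * zbinom (- int j) (int (b - a - k))) * \<beta> ^ (b - a)"
      by (simp add: sum_distrib_right)
    finally show ?thesis using True by (simp only: zbinom_vandermonde if_True)
  qed auto
  finally show ?thesis by (simp add: a_def b_def)
qed

lemma permutes_row_block:
  assumes p: "p permutes {..<n::nat}" and "k < n"
  shows "\<exists>i\<le>k. k \<le> p i" and "\<exists>i<n. k \<le> i \<and> p i \<le> k"
proof -
  show "\<exists>i\<le>k. k \<le> p i"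
  proof (rule ccontr)
    assume "\<not> (\<exists>i\<le>k. k \<le> p i)"
    then have "p ` {..k} \<subseteq> {..<k}" by auto
    then have "card {..k} \<le> card {..<k}"
      using permutes_inj_on[OF p] by (intro card_inj_on_le) auto
    then show False by simp
  qed
  show "\<exists>i<n. k \<le> i \<and> p i \<le> k"
  proof (rule ccontr)
    assume *: "\<not> (\<exists>i<n. k \<le> i \<and> p i \<le> k)"
    have "p ` {k..<n} \<subseteq> {Suc k..<n}"
      using * permutes_in_image[OF p] by force
    then have "card {k..<n} \<le> card {Suc k..<n}"
      using permutes_inj_on[OF p] by (intro card_inj_on_le) auto
    then show False using assms(2) by simp
  qed
qed

text \<open>At the first row \<open>k\<close> where \<open>lam\<close> and \<open>mu\<close> differ, the matrix has a zero block that is too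
  large: rows up to \<open>k\<close> and columns from \<open>k\<close> on if \<open>lam\<close> has the larger part there, and rows from
  \<open>k\<close> on and columns up to \<open>k\<close> otherwise.\<close>

lemma mcoeff_empty_pairing_det:
  assumes "ell lam \<le> n" "ell mu \<le> n"
  shows "mcoeff (pairing_det n lam mu) {#} = (if lam = mu then 1 else 0)"
proof -
  define E where "E = (\<lambda>i j. if stair n lam i \<le> stair n mu j
       then of_int (zbinom (int i - int j) (int (stair n mu j - stair n lam i)))
         * \<beta> ^ (stair n mu j - stair n lam i) else 0)"
  have "mcoeff (pairing_det n lam mu) {#} = dt n (\<lambda>i j. \<Sum>e\<le>psize lam + n. groth_col n lam i e * dual_col n mu j e)"
    unfolding pairing_det_def mcoeff_empty_dt
  proof (rule dt_cong)
    fix i j assume j: "j < n"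
    have "dual_col n mu j e = 0" if "psize mu + n < e" for e
      using that stair_le[OF j, of mu] by (simp add: dual_col_def)
    moreover have "(\<Sum>e'\<le>psize mu + n. groth_col n lam i e * dual_col n mu j e' * mcoeff (hsym (int e - int e')) {#})
        = (\<Sum>e'\<le>psize mu + n. if e' = e then groth_col n lam i e * dual_col n mu j e else 0)" for e
      by (rule sum.cong) (auto simp: hsym_def)
    ultimately show "mcoeff (\<Sum>e\<le>psize lam + n. \<Sum>e'\<le>psize mu + n.
        (groth_col n lam i e * dual_col n mu j e') *\<^sub>S hsym (int e - int e')) {#}
        = (\<Sum>e\<le>psize lam + n. groth_col n lam i e * dual_col n mu j e)"
      by (auto simp: not_le intro!: sum.cong)
  qed
  also have "\<dots> = dt n E"
    unfolding E_def by (rule dt_cong) (rule sum_groth_col_dual_col)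
  also have "\<dots> = (if lam = mu then 1 else 0)"
  proof (cases "lam = mu")
    case True
    have "dt n E = (\<Prod>i<n. E i i)"
    proof (rule dt_lower_triangular)
      fix i j assume "j < n" "i < j"
      then show "E i j = 0" using stair_less[of i j n mu] True by (simp add: E_def)
    qed
    then show ?thesis using True by (simp add: E_def zbinom_zero)
  next
    case False
    have above: "part lam (Suc i) < part mu (Suc j)" if "E i j \<noteq> 0" "i < j" "j < n" for i j
      using that by (auto simp: E_def stair_def split: if_splits)
    have below: "part mu (Suc j) \<le> part lam (Suc i)" if "E i j \<noteq> 0" "j < i" "i < n" for i j
    proof (rule ccontr)
      assume "\<not> part mu (Suc j) \<le> part lam (Suc i)"
      then have "i - j < stair n mu j - stair n lam i" using that by (simp add: stair_def)
      moreover have "int i - int j = int (i - j)" using that by (simp add: of_nat_diff)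
      ultimately have "zbinom (int i - int j) (int (stair n mu j - stair n lam i)) = 0"
        by (simp only: zbinom_binomial binomial_eq_0 of_nat_0)
      with that(1) show False by (simp add: E_def split: if_splits)
    qed
    have diag: "part lam (Suc i) = part mu (Suc i)" if "E i i \<noteq> 0" "i < n" for i
    proof -
      have le: "stair n lam i \<le> stair n mu i" and nz: "zbinom (int 0) (int (stair n mu i - stair n lam i)) \<noteq> 0"
        using that by (auto simp: E_def split: if_splits)
      from nz have "stair n mu i - stair n lam i = 0" unfolding zbinom_binomial by (simp add: binomial_eq_0_iff)
      with le that(2) show ?thesis by (simp add: stair_def)
    qed
    have "\<exists>k<n. part lam (Suc k) \<noteq> part mu (Suc k)"
      using False partition_eqI[OF assms] by blast
    then obtain k where k: "k < n" "part lam (Suc k) \<noteq> part mu (Suc k)" by blast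
    have "dt n E = 0"
    proof (rule dt_eq_zeroI, rule ccontr)
      fix p assume p: "p permutes {..<n}" and "\<not> (\<exists>i<n. E i (p i) = 0)"
      then have nz: "E i (p i) \<noteq> 0" and lt: "p i < n" if "i < n" for i
        using that permutes_in_image[OF p, of i] by auto
      show False
      proof (cases "part mu (Suc k) < part lam (Suc k)")
        case True
        obtain i where i: "i \<le> k" "k \<le> p i" using permutes_row_block(1)[OF p k(1)] by blast
        have "part mu (Suc (p i)) < part lam (Suc i)"
          using True part_antimono[of i k lam] part_antimono[of k "p i" mu] i by simp
        then show False
          using nz[of i] lt[of i] above[of i "p i"] diag[of i] i k True
          by (cases "p i = i") auto
      next
        case False
        obtain i where i: "i < n" "k \<le> i" "p i \<le> k" using permutes_row_block(2)[OF p k(1)] by blast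
        have "part lam (Suc i) < part mu (Suc (p i))"
          using False k part_antimono[of k i lam] part_antimono[of "p i" k mu] i by simp
        then show False
          using nz[of i] below[of i "p i"] diag[of i] i
          by (cases "p i = i") auto
      qed
    qed
    with False show ?thesis by simp
  qed
  finally show ?thesis .
qed

lemma hall_one_right: "f \<in> Sym \<Longrightarrow> hall f 1 = mcoeff f {#}"
  using hall_prod_hsym[where n = 0 and F = f] hall_commute[of f 1] by (simp add: cf_def expo_def)

lemma hall_hat_groth:
  assumes "F \<in> Sym" "ell lam \<le> n" "\<And>nu. scf F nu \<noteq> 0 \<Longrightarrow> ell nu \<le> n"
  shows "hall_hat (groth lam) F = hall (groth_det n lam) F"
proof -
  have "hall (groth_det n lam) F = (\<Sum>nu | scf F nu \<noteq> 0. scf (groth_det n lam) nu * scf F nu)"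
    using assms(1) by (intro hall_eq) (auto simp: finite_scf)
  also have "\<dots> = (\<Sum>nu | scf F nu \<noteq> 0. gcf lam nu * scf F nu)"
    by (rule sum.cong) (auto simp: scf_groth_det assms)
  finally show ?thesis
    using assms(1) by (simp add: hall_hat_def groth_eq_gcf schur_coeff_eq_scf)
qed

lemma hall_hat_groth_dual_det:
  "hall_hat (groth lam) (dual_det (ell mu) mu) = (if lam = mu then 1 else 0)"
proof -
  let ?g = "dual_det (ell mu) mu"
  have "finite (ell ` {nu. scf ?g nu \<noteq> 0} \<union> {ell lam, ell mu})" by (simp add: finite_scf)
  then obtain n where "ell ` {nu. scf ?g nu \<noteq> 0} \<union> {ell lam, ell mu} \<subseteq> {..n}"
    unfolding finite_nat_iff_bounded_le by blast
  then have n: "ell lam \<le> n" "ell mu \<le> n" "\<And>nu. scf ?g nu \<noteq> 0 \<Longrightarrow> ell nu \<le> n" by auto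
  have "hall_hat (groth lam) ?g = hall (groth_det n lam) (?g * 1)"
    using n by (simp add: hall_hat_groth)
  also have "\<dots> = hall (pairing_det n lam mu) 1"
    by (rule hall_pairing_det[symmetric, OF n(2)]) simp
  finally show ?thesis
    using n by (simp add: hall_one_right mcoeff_empty_pairing_det)
qed

text \<open>The coefficients \<open>gcf lam nu\<close> are unitriangular with respect to the size of \<open>nu\<close>, so a
  symmetric function that pairs to 0 with all \<open>groth lam\<close> has no term of maximal size.\<close>

lemma groth_pairing_unique:
  assumes "F \<in> Sym" "G \<in> Sym" "\<And>lam. hall_hat (groth lam) F = hall_hat (groth lam) G"
  shows "F = G"
proof (rule ccontr)
  assume "F \<noteq> G"
  define D where "D = {nu. scf F nu \<noteq> scf G nu}"
  have D: "D \<noteq> {}" using \<open>F \<noteq> G\<close> Sym_eqI[OF assms(1,2)] by (auto simp: D_def)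
  let ?A = "{nu. scf F nu \<noteq> 0} \<union> {nu. scf G nu \<noteq> 0}"
  have A: "finite ?A" using assms by (simp add: finite_scf)
  have DA: "D \<subseteq> ?A" by (auto simp: D_def)
  have finD: "finite D" using DA A by (rule finite_subset)
  obtain lam where lam: "lam \<in> D" "\<And>nu. nu \<in> D \<Longrightarrow> psize nu \<le> psize lam"
    using Max_in[of "psize ` D"] Max_ge[of "psize ` D"] finD D by fastforce
  have pair: "hall_hat (groth lam) H = (\<Sum>nu\<in>?A. gcf lam nu * scf H nu)" if "H = F \<or> H = G" for H
  proof -
    have "H \<in> Sym" using that assms by auto
    then have "schur_coeff H = scf H" by (rule schur_coeff_eq_scf)
    then show ?thesis
      unfolding hall_hat_def groth_eq_gcf using that A
      by (simp only:) (rule sum.mono_neutral_left; auto)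
  qed
  have "0 = (\<Sum>nu\<in>?A. gcf lam nu * (scf F nu - scf G nu))"
    using pair[of F] pair[of G] assms(3)[of lam] by (simp add: right_diff_distrib sum_subtractf)
  also have "\<dots> = (\<Sum>nu\<in>{lam}. gcf lam nu * (scf F nu - scf G nu))"
  proof (rule sum.mono_neutral_right[OF A])
    show "{lam} \<subseteq> ?A" using lam(1) DA by blast
    show "\<forall>nu\<in>?A - {lam}. gcf lam nu * (scf F nu - scf G nu) = 0"
    proof
      fix nu assume "nu \<in> ?A - {lam}"
      then show "gcf lam nu * (scf F nu - scf G nu) = 0"
        using lam(2)[of nu] gcf_eq_zero[of nu lam] by (cases "nu \<in> D") (auto simp: D_def)
    qed
  qed
  finally show False using lam(1) by (simp add: gcf_self D_def)
qed

lemma dual_groth_eq: "dual_groth mu = dual_det (ell mu) mu"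
  unfolding dual_groth_def
proof (rule the_equality)
  show "dual_det (ell mu) mu \<in> Sym \<and>
      (\<forall>lam. hall_hat (groth lam) (dual_det (ell mu) mu) = (if lam = mu then 1 else 0))"
    by (simp add: hall_hat_groth_dual_det)
  fix g assume "g \<in> Sym \<and> (\<forall>lam. hall_hat (groth lam) g = (if lam = mu then 1 else 0))"
  then show "g = dual_det (ell mu) mu"
    by (intro groth_pairing_unique) (simp_all add: hall_hat_groth_dual_det)
qed


section \<open>The determinant formula\<close>

lemma hall_nondegenerate:
  assumes "p \<in> Sym" "q \<in> Sym" "\<And>h. h \<in> Sym \<Longrightarrow> hall p h = hall q h"
  shows "p = q"
proof (rule Sym_eqI[OF assms(1,2)])
  fix nu
  have "hall f (schur nu) = scf f nu" if "f \<in> Sym" for f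
    using that by (subst hall_eq[of _ _ "{nu}"]) (auto simp: scf_schur split: if_splits)
  then show "scf p nu = scf q nu" using assms(3)[of "schur nu"] assms(1,2) by simp
qed

lemma perp_eqI:
  assumes "p \<in> Sym" "\<And>h. h \<in> Sym \<Longrightarrow> hall p h = hall g (f * h)"
  shows "perp f g = p"
  unfolding perp_def
proof (rule the_equality)
  fix q assume "q \<in> Sym \<and> (\<forall>h\<in>Sym. hall q h = hall g (f * h))"
  then show "q = p" using assms by (intro hall_nondegenerate) auto
qed (use assms in auto)

lemma perp_dual_groth_groth_trunc:
  assumes "ell lam \<le> r" "ell mu \<le> r"
  shows "perp (dual_groth mu) (groth_trunc r lam) = pairing_det r lam mu"
  unfolding groth_trunc_eq[OF assms(1)] dual_groth_eq
  by (rule perp_eqI) (simp_all add: hall_pairing_det assms)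

lemma pairing_entry:
  assumes i: "i < r" and j: "j < r"
  shows "(\<Sum>e\<le>psize lam + r. \<Sum>e'\<le>psize mu + r.
      (groth_col r lam i e * dual_col r mu j e') *\<^sub>S hsym (int e - int e'))
    = Sum_any (\<lambda>n::nat. \<Sum>k = 0..stair r mu j.
        (of_int (zbinom (- int j) (int k)) * of_int (zbinom (int i) (int n - int k)) * \<beta> ^ n)
          *\<^sub>S hsym (int (stair r lam i) - int (stair r mu j) + int n))"
proof -
  define a b where "a = stair r lam i" and "b = stair r mu j"
  define z where "z = (\<lambda>k. of_int (zbinom (- int j) (int k)) :: scalar)"
  define H where "H = (\<lambda>n::nat. hsym (int a - int b + int n))"
  define W where "W = (\<lambda>n k. (z k * of_int (zbinom (int i) (int n - int k)) * \<beta> ^ n) *\<^sub>S H n)"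
  have W_zero: "W n k = 0" if "n \<notin> {k..k + i}" for n k
  proof -
    have "zbinom (int i) (int n - int k) = 0"
    proof (cases "n < k")
      case False
      then have eq: "int n - int k = int (n - k)" by (simp add: of_nat_diff)
      show ?thesis using that False unfolding eq zbinom_binomial by (simp add: binomial_eq_0)
    qed (simp add: zbinom_def)
    then show ?thesis by (simp add: W_def)
  qed
  have "(\<Sum>e\<le>psize lam + r. \<Sum>e'\<le>psize mu + r.
      (groth_col r lam i e * dual_col r mu j e') *\<^sub>S hsym (int e - int e'))
      = (\<Sum>m\<le>i. \<Sum>e'\<le>psize mu + r. (of_nat (i choose m) * \<beta> ^ m * dual_col r mu j e')
          *\<^sub>S hsym (int (a + m) - int e'))"
    using stair_le[OF i, of lam]
    by (subst sum_groth_col[of r lam i]) (auto simp: groth_col_stair_add a_def intro!: sum.cong)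
  also have "\<dots> = (\<Sum>m\<le>i. \<Sum>k\<le>b. W (k + m) k)"
  proof (rule sum.cong[OF refl])
    fix m assume "m \<in> {..i}"
    have "(\<Sum>e'\<le>psize mu + r. (of_nat (i choose m) * \<beta> ^ m * dual_col r mu j e') *\<^sub>S hsym (int (a + m) - int e'))
        = (\<Sum>e'\<le>b. (of_nat (i choose m) * \<beta> ^ m * dual_col r mu j e') *\<^sub>S hsym (int (a + m) - int e'))"
      using stair_le[OF j, of mu] by (intro sum.mono_neutral_right) (auto simp: dual_col_def b_def)
    also have "\<dots> = (\<Sum>k\<le>b. W (k + m) k)"
    proof (rule sum.reindex_bij_witness[where i = "\<lambda>k. b - k" and j = "\<lambda>e. b - e"])
      fix e assume e: "e \<in> {..b}"
      then have sub: "int (a + m) - int e = int a - int b + int (b - e + m)" by (simp add: of_nat_diff)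
      have m: "int (b - e + m) - int (b - e) = int m" by simp
      have "dual_col r mu j e = z (b - e) * \<beta> ^ (b - e)"
        using e by (simp add: dual_col_def z_def b_def)
      moreover have "of_nat (i choose m) = (of_int (zbinom (int i) (int m)) :: scalar)"
        by (simp add: zbinom_binomial)
      ultimately show "W (b - e + m) (b - e)
          = (of_nat (i choose m) * \<beta> ^ m * dual_col r mu j e) *\<^sub>S hsym (int (a + m) - int e)"
        unfolding W_def H_def m sub power_add by (simp only: mult_ac)
    qed auto
    finally show "(\<Sum>e'\<le>psize mu + r. (of_nat (i choose m) * \<beta> ^ m * dual_col r mu j e') *\<^sub>S hsym (int (a + m) - int e'))
        = (\<Sum>k\<le>b. W (k + m) k)" .
  qed
  also have "\<dots> = (\<Sum>k\<le>b. \<Sum>m\<le>i. W (k + m) k)"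
    by (rule sum.swap)
  also have "\<dots> = (\<Sum>k\<le>b. \<Sum>n\<le>b + i. W n k)"
  proof (rule sum.cong[OF refl])
    fix k assume "k \<in> {..b}"
    then have "(\<Sum>n\<le>b + i. W n k) = (\<Sum>n\<in>{k..k + i}. W n k)"
      using W_zero by (intro sum.mono_neutral_right) auto
    also have "\<dots> = (\<Sum>m\<le>i. W (k + m) k)"
      by (rule sum.reindex_bij_witness[where i = "\<lambda>m. k + m" and j = "\<lambda>n. n - k"]) auto
    finally show "(\<Sum>m\<le>i. W (k + m) k) = (\<Sum>n\<le>b + i. W n k)" by simp
  qed
  also have "\<dots> = (\<Sum>n\<le>b + i. \<Sum>k\<le>b. W n k)"
    by (rule sum.swap)
  also have "\<dots> = Sum_any (\<lambda>n. \<Sum>k\<le>b. W n k)"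
  proof (rule Sum_any.expand_superset[symmetric])
    show "{n. (\<Sum>k\<le>b. W n k) \<noteq> 0} \<subseteq> {..b + i}"
    proof (rule subsetI, rule ccontr)
      fix n assume "n \<in> {n. (\<Sum>k\<le>b. W n k) \<noteq> 0}" "n \<notin> {..b + i}"
      moreover from this(2) have "(\<Sum>k\<le>b. W n k) = 0" by (intro sum.neutral ballI W_zero) auto
      ultimately show False by simp
    qed
  qed simp
  finally show ?thesis
    by (simp add: W_def H_def z_def a_def b_def atLeast0AtMost)
qed

theorem proposition4p8:
  fixes r :: nat and lam mu :: partition
  assumes "r \<ge> 1" and "ell lam \<le> r" and "ell mu \<le> r"
  shows "perp (dual_groth mu) (groth_trunc r lam)
    = det1 r (\<lambda>i j. Sum_any (\<lambda>n::nat. \<Sum>k = 0..part mu j + r - j.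
        (of_int (zbinom (1 - int j) (int k)) * of_int (zbinom (int i - 1) (int n - int k)) * \<beta> ^ n)
          *\<^sub>S hsym (int (part lam i) - int (part mu j) - int i + int j + int n)))"
  unfolding perp_dual_groth_groth_trunc[OF assms(2,3)] pairing_det_def det1_eq_dt
proof (rule dt_cong)
  fix i j assume ij: "i < r" "j < r"
  have "int (stair r lam i) - int (stair r mu j)
      = int (part lam (Suc i)) - int (part mu (Suc j)) - int (Suc i) + int (Suc j)"
    using ij by (simp add: stair_shifted shifted_def)
  then show "(\<Sum>e\<le>psize lam + r. \<Sum>e'\<le>psize mu + r.
      (groth_col r lam i e * dual_col r mu j e') *\<^sub>S hsym (int e - int e'))
    = Sum_any (\<lambda>n::nat. \<Sum>k = 0..part mu (Suc j) + r - Suc j.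
        (of_int (zbinom (1 - int (Suc j)) (int k)) * of_int (zbinom (int (Suc i) - 1) (int n - int k)) * \<beta> ^ n)
          *\<^sub>S hsym (int (part lam (Suc i)) - int (part mu (Suc j)) - int (Suc i) + int (Suc j) + int n))"
    unfolding pairing_entry[OF ij] by (simp add: stair_def)
qed

end
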